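(* Let $R\subset S$ be a ring extension of length 2. Then: (1) Either $R\subset S$ is pointwise minimal (equivalently, co-pointwise minimal), or there exists $x\in S$ such that $S=R[x]$ (that is, $R\subset S$ is simple), and these two conditions are mutually exclusive. (2) $R\subset S$ is a quasi-Prüfer extension; so that, denoting by $\overline R$ the integral closure of $R$ in $S$, either $\overline R\in\{R,S\}$, or both $R\subset\overline R$ and $\overline R\subset S$ are minimal extensions.
   Context: Rings are commutative and unital; $R\subset S$ denotes a proper ring extension and $[R,S]$ the set of all $R$-subalgebras of $S$. The length $\ell[R,S]$ is the supremum of the lengths $n$ of chains $R_0\subset R_1\subset\cdots\subset R_n$ of elements of $[R,S]$; the extension has length 2 if $\ell[R,S]=2$. An extension $A\subset B$ ($A\ne B$) is minimal if $[A,B]=\{A,B\}$. $R\subset S$ is pointwise minimal if $R\subset R[t]$ is minimal for each $t\in S\setminus R$, and co-pointwise minimal if $R[x]\subset S$ is minimal for each $x\in S\setminus R$. An extension $A\subseteq B$ is Prüfer if $A\subseteq T$ is a flat epimorphism (in the category of commutative rings) for each $T\in[A,B]$; $R\subseteq S$ is quasi-Prüfer if $\overline R\subseteq S$ is Prüfer. *)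

theory Defs
  imports "HOL-Algebra.Algebra" "HOL-Library.Extended_Nat"
begin

text \<open>
  Ring extensions are pairs \<open>A \<subseteq> B\<close> of subrings of an ambient commutative ring \<open>S\<close>, given by their
  carrier sets. An \<open>A\<close>-subalgebra of \<open>B\<close> is then the same thing as a subring of \<open>S\<close> lying
  between \<open>A\<close> and \<open>B\<close>.
\<close>

definition intermediate_rings :: "('a, 'b) ring_scheme \<Rightarrow> 'a set \<Rightarrow> 'a set \<Rightarrow> 'a set set" where
  "intermediate_rings S A B = {T. subring T S \<and> A \<subseteq> T \<and> T \<subseteq> B}"

definition extension_length :: "('a, 'b) ring_scheme \<Rightarrow> 'a set \<Rightarrow> 'a set \<Rightarrow> enat" where
  "extension_length S A B =
     Sup {enat n | n. \<exists>C. (\<forall>i\<le>n. C i \<in> intermediate_rings S A B) \<and> (\<forall>i<n. C i \<subset> C (Suc i))}"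

definition minimal_extension :: "('a, 'b) ring_scheme \<Rightarrow> 'a set \<Rightarrow> 'a set \<Rightarrow> bool" where
  "minimal_extension S A B \<longleftrightarrow> A \<noteq> B \<and> intermediate_rings S A B = {A, B}"

definition pointwise_minimal :: "('a, 'b) ring_scheme \<Rightarrow> 'a set \<Rightarrow> 'a set \<Rightarrow> bool" where
  "pointwise_minimal S A B \<longleftrightarrow>
     A \<subset> B \<and> (\<forall>t \<in> B - A. minimal_extension S A (ring.simple_extension S A t))"

definition copointwise_minimal :: "('a, 'b) ring_scheme \<Rightarrow> 'a set \<Rightarrow> 'a set \<Rightarrow> bool" where
  "copointwise_minimal S A B \<longleftrightarrow>
     A \<subset> B \<and> (\<forall>x \<in> B - A. minimal_extension S (ring.simple_extension S A x) B)"

definition integral_closure :: "('a, 'b) ring_scheme \<Rightarrow> 'a set \<Rightarrow> 'a set \<Rightarrow> 'a set" where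
  "integral_closure S A B =
     {x \<in> B. \<exists>p \<in> carrier (univ_poly S A).
        p \<noteq> [] \<and> lead_coeff p = \<one>\<^bsub>S\<^esub> \<and> ring.eval S p x = \<zero>\<^bsub>S\<^esub>}"


text \<open>
  The tensor product \<open>P \<otimes>\<^sub>R M\<close>, as an abelian group: the free abelian group on
  \<open>P \<times> M\<close> modulo the subgroup generated by the bilinearity relations.
\<close>

definition tensor_relations ::
    "('r, 'b) ring_scheme \<Rightarrow> ('r, 'p, 'c) module_scheme \<Rightarrow> ('r, 'm, 'd) module_scheme
      \<Rightarrow> (('p \<times> 'm) \<Rightarrow>\<^sub>0 int) set" where
  "tensor_relations R P M = generate (free_Abelian_group (carrier P \<times> carrier M))
     ({frag_of (x \<oplus>\<^bsub>P\<^esub> x', y) - frag_of (x, y) - frag_of (x', y) | x x' y.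
         x \<in> carrier P \<and> x' \<in> carrier P \<and> y \<in> carrier M} \<union>
      {frag_of (x, y \<oplus>\<^bsub>M\<^esub> y') - frag_of (x, y) - frag_of (x, y') | x y y'.
         x \<in> carrier P \<and> y \<in> carrier M \<and> y' \<in> carrier M} \<union>
      {frag_of (r \<odot>\<^bsub>P\<^esub> x, y) - frag_of (x, r \<odot>\<^bsub>M\<^esub> y) | r x y.
         r \<in> carrier R \<and> x \<in> carrier P \<and> y \<in> carrier M})"

definition tensor_product ::
    "('r, 'b) ring_scheme \<Rightarrow> ('r, 'p, 'c) module_scheme \<Rightarrow> ('r, 'm, 'd) module_scheme
      \<Rightarrow> (('p \<times> 'm) \<Rightarrow>\<^sub>0 int) set monoid" where
  "tensor_product R P M =
     free_Abelian_group (carrier P \<times> carrier M) Mod tensor_relations R P M"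

definition module_homs ::
    "('r, 'b) ring_scheme \<Rightarrow> ('r, 'p, 'c) module_scheme \<Rightarrow> ('r, 'q, 'd) module_scheme
      \<Rightarrow> ('p \<Rightarrow> 'q) set" where
  "module_homs R P Q = {h \<in> hom (add_monoid P) (add_monoid Q).
     \<forall>r \<in> carrier R. \<forall>x \<in> carrier P. h (r \<odot>\<^bsub>P\<^esub> x) = r \<odot>\<^bsub>Q\<^esub> h x}"

text \<open>
  The map \<open>h \<otimes> id : P \<otimes>\<^sub>R M \<rightarrow> Q \<otimes>\<^sub>R M\<close>. All representatives of a coset \<open>K\<close> of the relations
  have images in one and the same coset, which \<open>the_elem\<close> extracts.
\<close>

definition tensor_map ::
    "('r, 'b) ring_scheme \<Rightarrow> ('r, 'q, 'd) module_scheme \<Rightarrow> ('r, 'm, 'e) module_scheme \<Rightarrow> ('p \<Rightarrow> 'q)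
      \<Rightarrow> (('p \<times> 'm) \<Rightarrow>\<^sub>0 int) set \<Rightarrow> (('q \<times> 'm) \<Rightarrow>\<^sub>0 int) set" where
  "tensor_map R Q M h K =
     the_elem ((\<lambda>u. tensor_relations R Q M #>\<^bsub>free_Abelian_group (carrier Q \<times> carrier M)\<^esub>
                      frag_extend (\<lambda>(x, y). frag_of (h x, y)) u) ` K)"

text \<open>
  Flatness and the epimorphism property quantify over all modules and over all commutative rings.
  A single HOL formula can only quantify over carriers in a fixed type, so both notions take that
  type \<open>'u\<close> as a parameter; the unrestricted notion is the one asserted for every \<open>'u\<close>, as happens
  when \<open>'u\<close> is a type variable in the conclusion of a theorem.
\<close>

definition flat_module ::
    "'u itself \<Rightarrow> ('r, 'b) ring_scheme \<Rightarrow> ('r, 'm, 'c) module_scheme \<Rightarrow> bool" where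
  "flat_module U R M \<longleftrightarrow> module R M \<and>
     (\<forall>(P :: ('r, 'u) module) (Q :: ('r, 'u) module) h.
        module R P \<and> module R Q \<and> h \<in> module_homs R P Q \<and> inj_on h (carrier P) \<longrightarrow>
        inj_on (tensor_map R Q M h) (carrier (tensor_product R P M)))"

definition cring_epimorphism ::
    "'u itself \<Rightarrow> ('a, 'c) ring_scheme \<Rightarrow> ('b, 'd) ring_scheme \<Rightarrow> ('a \<Rightarrow> 'b) \<Rightarrow> bool" where
  "cring_epimorphism U A B f \<longleftrightarrow> f \<in> ring_hom A B \<and>
     (\<forall>(C :: 'u ring). cring C \<longrightarrow>
        (\<forall>g \<in> ring_hom B C. \<forall>h \<in> ring_hom B C.
           (\<forall>x \<in> carrier A. g (f x) = h (f x)) \<longrightarrow> (\<forall>y \<in> carrier B. g y = h y)))"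

definition subring_module :: "('a, 'b) ring_scheme \<Rightarrow> 'a set \<Rightarrow> ('a, 'a) module" where
  "subring_module S T =
     \<lparr>carrier = T, monoid.mult = (\<otimes>\<^bsub>S\<^esub>), one = \<one>\<^bsub>S\<^esub>, ring.zero = \<zero>\<^bsub>S\<^esub>, ring.add = (\<oplus>\<^bsub>S\<^esub>), module.smult = (\<otimes>\<^bsub>S\<^esub>)\<rparr>"

definition flat_epimorphic_extension ::
    "'u itself \<Rightarrow> ('a, 'b) ring_scheme \<Rightarrow> 'a set \<Rightarrow> 'a set \<Rightarrow> bool" where
  "flat_epimorphic_extension U S A T \<longleftrightarrow>
     flat_module U (S\<lparr>carrier := A\<rparr>) (subring_module S T) \<and>
     cring_epimorphism U (S\<lparr>carrier := A\<rparr>) (S\<lparr>carrier := T\<rparr>) (\<lambda>x. x)"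

definition pruefer_extension ::
    "'u itself \<Rightarrow> ('a, 'b) ring_scheme \<Rightarrow> 'a set \<Rightarrow> 'a set \<Rightarrow> bool" where
  "pruefer_extension U S A B \<longleftrightarrow>
     (\<forall>T \<in> intermediate_rings S A B. flat_epimorphic_extension U S A T)"

definition quasi_pruefer_extension ::
    "'u itself \<Rightarrow> ('a, 'b) ring_scheme \<Rightarrow> 'a set \<Rightarrow> 'a set \<Rightarrow> bool" where
  "quasi_pruefer_extension U S A B \<longleftrightarrow> pruefer_extension U S (integral_closure S A B) B"

end

theory Submission
  imports Defs
begin

text \<open>
  Integrality: \<open>x\<close> is integral over \<open>A\<close> iff \<open>x\<^sup>n\<close> lies in the \<open>A\<close>-span of the lower powers, and
  elements of module-finite rings are integral; hence the integral closure \<open>A\<close> of \<open>R\<close> in \<open>S\<close> is an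
  integrally closed subring. For \<open>u \<in> S\<close> the chain \<open>A[u\<^sup>8] \<subseteq> A[u\<^sup>4] \<subseteq> A[u\<^sup>2] \<subseteq> A[u]\<close> has a repetition, so
  \<open>u\<close> is a root of a polynomial over \<open>A\<close> with a coefficient \<open>-1\<close>. As \<open>A\<close> is integrally closed,
  every Horner prefix \<open>d\<close> of that polynomial satisfies \<open>d, d u \<in> A\<close>, which yields \<open>a, b \<in> A\<close> with
  \<open>a u, b u \<in> A\<close> and \<open>a - b u = 1\<close>: the ideal \<open>(A : u)\<close> generates the unit ideal of \<open>A[u]\<close>. If this
  holds for all \<open>u \<in> T\<close>, then \<open>A \<subseteq> T\<close> is a flat epimorphism, because a tensor
  \<open>\<Sum> p\<^sub>i \<otimes> t\<^sub>i\<close> vanishes in \<open>P \<otimes>\<^sub>A T\<close> iff the \<open>j \<in> A\<close> with all \<open>j t\<^sub>i \<in> A\<close> and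
  \<open>\<Sum> (j t\<^sub>i) p\<^sub>i = 0\<close> generate the unit ideal of \<open>T\<close>, a condition reflected by injections \<open>P \<rightarrow> Q\<close>.
  The remaining claims are read off from the chains of length at most 2.
\<close>

section \<open>Finite and integral ring extensions\<close>

definition (in ring) submodule_of_ring :: "'a set \<Rightarrow> 'a set \<Rightarrow> bool" where
  "submodule_of_ring A W \<longleftrightarrow> W \<subseteq> carrier R \<and> \<zero> \<in> W \<and>
     (\<forall>v\<in>W. \<forall>w\<in>W. v \<oplus> w \<in> W) \<and> (\<forall>a\<in>A. \<forall>w\<in>W. a \<otimes> w \<in> W)"

text \<open>\<open>W\<close> is a set of coefficients, not necessarily a ring: the elimination
  argument below takes coefficients from \<open>power_span A x d\<close>, which need not be closed
  under multiplication.\<close>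

primrec (in ring) lin_span :: "'a set \<Rightarrow> 'a list \<Rightarrow> 'a set" where
  "lin_span W [] = {\<zero>}"
| "lin_span W (m # ms) = {w \<otimes> m \<oplus> s | w s. w \<in> W \<and> s \<in> lin_span W ms}"

text \<open>The powers descend from exponent \<open>n - 1\<close> to 0, which is the coefficient
  order of \<open>eval\<close>.\<close>

primrec (in ring) powers_below :: "'a \<Rightarrow> nat \<Rightarrow> 'a list" where
  "powers_below x 0 = []"
| "powers_below x (Suc n) = x [^] n # powers_below x n"

abbreviation (in ring) power_span :: "'a set \<Rightarrow> 'a \<Rightarrow> nat \<Rightarrow> 'a set" where
  "power_span A x n \<equiv> lin_span A (powers_below x n)"

text \<open>A monic equation, stated through spans so that linear algebra can produce it. Exponent 0
  adds no degenerate solutions: it would force \<open>\<one> = \<zero>\<close>.\<close>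

definition (in ring) integral_over :: "'a set \<Rightarrow> 'a \<Rightarrow> bool" where
  "integral_over A x \<longleftrightarrow> x \<in> carrier R \<and> (\<exists>n. x [^] n \<in> power_span A x n)"

definition (in ring) module_finite :: "'a set \<Rightarrow> 'a set \<Rightarrow> bool" where
  "module_finite A C \<longleftrightarrow> (\<exists>ms. set ms \<subseteq> C \<and> C \<subseteq> lin_span A ms)"

section \<open>Linear spans of lists of generators\<close>

context cring
begin

lemma lin_span_mono: "W \<subseteq> W' \<Longrightarrow> lin_span W ms \<subseteq> lin_span W' ms"
  by (induction ms) (simp, force)

lemma lin_span_closed:
  assumes "W \<subseteq> carrier R" "set ms \<subseteq> carrier R"
  shows "lin_span W ms \<subseteq> carrier R"
  using assms(2) by (induction ms) (use assms(1) in auto)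

text \<open>Two coefficient sets \<open>W\<close> and \<open>W'\<close> are kept apart because
  multiplication by \<open>c\<close> may enlarge the coefficients, as when a power of
  \<open>x\<close> raises a degree bound.\<close>

lemma lin_span_mult:
  assumes "W \<subseteq> carrier R" "c \<in> carrier R" "set ms \<subseteq> carrier R"
    and "\<And>w. w \<in> W \<Longrightarrow> c \<otimes> w \<in> W'"
    and "s \<in> lin_span W ms"
  shows "c \<otimes> s \<in> lin_span W' ms"
  using assms(3,5)
proof (induction ms arbitrary: s)
  case (Cons m ms)
  then obtain w t where s: "s = w \<otimes> m \<oplus> t" "w \<in> W" "t \<in> lin_span W ms"
    by auto
  then have "t \<in> carrier R" using lin_span_closed assms(1) Cons.prems(1) by (meson set_subset_Cons subset_iff)
  then have "c \<otimes> s = (c \<otimes> w) \<otimes> m \<oplus> c \<otimes> t"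
    using s assms(1,2) Cons.prems(1) by (simp add: r_distr m_assoc subset_iff)
  then show ?case using Cons s assms(4) by auto
qed (use assms(2) in simp)

lemma zero_in_lin_span:
  assumes "\<zero> \<in> W" "set ms \<subseteq> carrier R"
  shows "\<zero> \<in> lin_span W ms"
  using assms(2)
proof (induction ms)
  case (Cons m ms)
  then have "\<zero> = \<zero> \<otimes> m \<oplus> \<zero>" "\<zero> \<in> lin_span W ms" by auto
  then show ?case using assms(1) by auto
qed simp

lemma submodule_lin_span:
  assumes "submodule_of_ring A W" "A \<subseteq> carrier R" "set ms \<subseteq> carrier R"
  shows "submodule_of_ring A (lin_span W ms)"
proof -
  have W: "W \<subseteq> carrier R" "\<zero> \<in> W" "\<And>v w. v \<in> W \<Longrightarrow> w \<in> W \<Longrightarrow> v \<oplus> w \<in> W"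
    "\<And>a w. a \<in> A \<Longrightarrow> w \<in> W \<Longrightarrow> a \<otimes> w \<in> W"
    using assms(1) by (auto simp: submodule_of_ring_def)
  have 0: "\<zero> \<in> lin_span W ms"
    using zero_in_lin_span W(2) assms(3) .
  have add: "s \<oplus> t \<in> lin_span W ms" if "s \<in> lin_span W ms" "t \<in> lin_span W ms" for s t
    using assms(3) that
  proof (induction ms arbitrary: s t)
    case (Cons m ms)
    then obtain v w s' t' where s: "s = v \<otimes> m \<oplus> s'" "v \<in> W" "s' \<in> lin_span W ms"
      and t: "t = w \<otimes> m \<oplus> t'" "w \<in> W" "t' \<in> lin_span W ms"
      by auto
    have c: "m \<in> carrier R" "v \<in> carrier R" "w \<in> carrier R" "s' \<in> carrier R" "t' \<in> carrier R"
      using s t Cons.prems(1) W(1) lin_span_closed[OF W(1)] by (auto simp: subset_iff)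
    then have "s \<oplus> t = (v \<oplus> w) \<otimes> m \<oplus> (s' \<oplus> t')"
      unfolding s t by algebra
    moreover have "v \<oplus> w \<in> W" "s' \<oplus> t' \<in> lin_span W ms" using Cons s t W(3) by auto
    ultimately show ?case by auto
  qed simp
  show ?thesis
    unfolding submodule_of_ring_def
    using lin_span_closed[OF W(1) assms(3)] 0 add lin_span_mult[OF W(1) _ assms(3)] W(4) assms(2)
    by (meson subset_iff)
qed

lemma lin_span_base:
  assumes "w \<in> W" "\<zero> \<in> W" "W \<subseteq> carrier R" "m \<in> set ms" "set ms \<subseteq> carrier R"
  shows "w \<otimes> m \<in> lin_span W ms"
  using assms(4,5)
proof (induction ms)
  case (Cons a ms)
  have z: "\<zero> \<in> lin_span W ms"
    using zero_in_lin_span assms(2) Cons.prems(2) by simp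
  have sub: "lin_span W ms \<subseteq> carrier R"
    using lin_span_closed assms Cons.prems by simp
  show ?case
  proof (cases "m = a")
    case True
    then have "w \<otimes> m = w \<otimes> a \<oplus> \<zero>" using assms Cons.prems by auto
    then show ?thesis using z assms(1) by auto
  next
    case False
    then have *: "w \<otimes> m \<in> lin_span W ms" using Cons by auto
    then have "w \<otimes> m = \<zero> \<otimes> a \<oplus> (w \<otimes> m)" using sub Cons.prems by auto
    then show ?thesis using * assms(2) by fastforce
  qed
qed simp

lemma lin_span_append:
  assumes "W \<subseteq> carrier R" "set ms \<subseteq> carrier R" "set ns \<subseteq> carrier R"
    and "s \<in> lin_span W ms" "t \<in> lin_span W ns"
  shows "s \<oplus> t \<in> lin_span W (ms @ ns)"
  using assms(2,4)
proof (induction ms arbitrary: s)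
  case Nil
  then show ?case using assms lin_span_closed[OF assms(1,3)] by auto
next
  case (Cons m ms)
  then obtain w s' where s: "s = w \<otimes> m \<oplus> s'" "w \<in> W" "s' \<in> lin_span W ms"
    by auto
  have "w \<in> carrier R" "m \<in> carrier R" "s' \<in> carrier R" "t \<in> carrier R"
    using s assms(1,5) Cons.prems(1) lin_span_closed[OF assms(1), of ms]
      lin_span_closed[OF assms(1,3)] by auto
  then have "s \<oplus> t = w \<otimes> m \<oplus> (s' \<oplus> t)"
    unfolding s by algebra
  then show ?case using Cons s by auto
qed

lemma submodule_subring: "subring A R \<Longrightarrow> submodule_of_ring A A"
  by (auto simp: submodule_of_ring_def dest: subringE)

section \<open>Spans of the powers of one element\<close>

lemma powers_below_closed: "x \<in> carrier R \<Longrightarrow> set (powers_below x n) \<subseteq> carrier R"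
  by (induction n) auto

context
  fixes A x
  assumes A: "subring A R" and x: "x \<in> carrier R"
begin

lemma submodule_power_span: "submodule_of_ring A (power_span A x n)"
  using submodule_lin_span[OF submodule_subring[OF A]] subringE(1)[OF A] powers_below_closed[OF x]
  by simp

lemma power_span_simps:
  shows "power_span A x n \<subseteq> carrier R" "\<zero> \<in> power_span A x n"
    "\<And>s t. s \<in> power_span A x n \<Longrightarrow> t \<in> power_span A x n \<Longrightarrow> s \<oplus> t \<in> power_span A x n"
    "\<And>a t. a \<in> A \<Longrightarrow> t \<in> power_span A x n \<Longrightarrow> a \<otimes> t \<in> power_span A x n"
  using submodule_power_span[of n] by (auto simp: submodule_of_ring_def)

lemma power_span_uminus: "t \<in> power_span A x n \<Longrightarrow> \<ominus> t \<in> power_span A x n"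
  using power_span_simps(1)[of n] power_span_simps(4)[of "\<ominus> \<one>" t n] subringE(3,5)[OF A]
  by (auto simp: l_minus subset_iff)

lemma power_span_Suc: "power_span A x n \<subseteq> power_span A x (Suc n)"
proof
  fix t assume t: "t \<in> power_span A x n"
  then have "t = \<zero> \<otimes> x [^] n \<oplus> t" using power_span_simps(1)[of n] x by auto
  then show "t \<in> power_span A x (Suc n)" using t subringE(2)[OF A] by fastforce
qed

lemma power_span_mono: "m \<le> n \<Longrightarrow> power_span A x m \<subseteq> power_span A x n"
  by (rule lift_Suc_mono_le[of "power_span A x"]) (rule power_span_Suc)

lemma power_span_mult_gen: "t \<in> power_span A x n \<Longrightarrow> x \<otimes> t \<in> power_span A x (Suc n)"
proof (induction n arbitrary: t)
  case (Suc n)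
  then obtain a s where t: "t = a \<otimes> x [^] n \<oplus> s" "a \<in> A" "s \<in> power_span A x n"
    by auto
  have c: "a \<in> carrier R" "s \<in> carrier R" "x [^] n \<in> carrier R"
    using t subringE(1)[OF A] power_span_simps(1)[of n] x by auto
  have "x \<otimes> t = a \<otimes> x [^] Suc n \<oplus> x \<otimes> s"
    unfolding t nat_pow_Suc using c x by algebra
  then show ?case using Suc.IH[OF t(3)] t(2) by auto
qed (use x subringE(2)[OF A] in force)

lemma power_span_mult_power: "t \<in> power_span A x n \<Longrightarrow> x [^] k \<otimes> t \<in> power_span A x (n + k)"
proof (induction k)
  case 0
  then show ?case using power_span_simps(1)[of n] by auto
next
  case (Suc k)
  then have "x \<otimes> (x [^] k \<otimes> t) \<in> power_span A x (n + Suc k)"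
    using power_span_mult_gen[of _ "n + k"] by simp
  moreover have "t \<in> carrier R" using Suc.prems power_span_simps(1) by auto
  ultimately show ?case using x by (simp del: powers_below.simps add: m_assoc m_lcomm m_comm[of x])
qed

text \<open>The bound \<open>m + n\<close> is one above what the degrees give. It agrees with
  \<open>power_span_mult_power\<close>, so that in the elimination below all products land in
  \<open>power_span A x (d + d)\<close>.\<close>

lemma power_span_mult:
  "s \<in> power_span A x m \<Longrightarrow> t \<in> power_span A x n \<Longrightarrow> s \<otimes> t \<in> power_span A x (m + n)"
proof (induction m arbitrary: s)
  case 0
  then show ?case using power_span_simps(1,2)[of n] by auto
next
  case (Suc m)
  then obtain a s' where s: "s = a \<otimes> x [^] m \<oplus> s'" "a \<in> A" "s' \<in> power_span A x m"
    by auto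
  have c: "a \<in> carrier R" "s' \<in> carrier R" "x [^] m \<in> carrier R" "t \<in> carrier R"
    using s Suc.prems subringE(1)[OF A] power_span_simps(1) x by auto
  have "s \<otimes> t = a \<otimes> (x [^] m \<otimes> t) \<oplus> s' \<otimes> t"
    unfolding s using c by algebra
  moreover have "a \<otimes> (x [^] m \<otimes> t) \<in> power_span A x (Suc m + n)"
    using power_span_simps(4)[OF s(2) power_span_mult_power[OF Suc.prems(2), of m]] power_span_mono[where m = "n + m" and n = "Suc m + n"]
    by (auto simp: add.commute)
  moreover have "s' \<otimes> t \<in> power_span A x (Suc m + n)"
    using Suc.IH[OF s(3) Suc.prems(2)] power_span_mono[where m = "m + n" and n = "Suc m + n"] by auto
  ultimately show ?case using power_span_simps(3) by (simp del: powers_below.simps)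
qed

lemma subset_power_span: "0 < n \<Longrightarrow> A \<subseteq> power_span A x n"
proof
  fix a assume n: "0 < n" and a: "a \<in> A"
  then have "a = a \<otimes> x [^] (0::nat) \<oplus> \<zero>" using subringE(1)[OF A] by auto
  then have "a \<in> power_span A x 1" using a by auto
  then show "a \<in> power_span A x n" using n power_span_mono[of 1 n] by auto
qed

text \<open>The lists have length exactly \<open>n\<close> and may begin with zeros. This is the
  bridge from spans to polynomials.\<close>

lemma power_span_as_eval: "t \<in> power_span A x n \<longleftrightarrow> (\<exists>p. set p \<subseteq> A \<and> length p = n \<and> eval p x = t)"
proof (induction n arbitrary: t)
  case (Suc n)
  show ?case (is "_ \<longleftrightarrow> (\<exists>p. ?P p)")
  proof
    assume "t \<in> power_span A x (Suc n)"
    then obtain a s where t: "t = a \<otimes> x [^] n \<oplus> s" "a \<in> A" "s \<in> power_span A x n"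
      by auto
    then obtain p where "set p \<subseteq> A" "length p = n" "eval p x = s" using Suc by auto
    then have "?P (a # p)" using t by auto
    then show "\<exists>p. ?P p" ..
  next
    assume "\<exists>p. ?P p"
    then obtain a p where "set (a # p) \<subseteq> A" "length p = n" "eval (a # p) x = t"
      by (metis length_Suc_conv)
    then show "t \<in> power_span A x (Suc n)" using Suc by auto
  qed
qed auto

text \<open>The generators are eliminated one at a time, each elimination doubling \<open>d\<close>: this
  replaces the usual determinant argument.\<close>
lemma integral_by_elimination:
  assumes "set ms \<subseteq> carrier R"
    and "\<And>m. m \<in> set (ms @ [\<one>]) \<Longrightarrow> x [^] d \<otimes> m \<in> lin_span (power_span A x d) (ms @ [\<one>])"
  shows "integral_over A x"
  using assms
proof (induction ms arbitrary: d)
  case Nil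
  \<comment> \<open>With \<open>\<one>\<close> as the only generator left, the relation is itself a
    monic equation for \<open>x\<close>.\<close>
  then have "x [^] d \<otimes> \<one> \<in> lin_span (power_span A x d) [\<one>]" by simp
  then obtain q where "q \<in> power_span A x d" "x [^] d \<otimes> \<one> = q \<otimes> \<one> \<oplus> \<zero>" by auto
  then have "x [^] d \<in> power_span A x d" using power_span_simps(1)[of d] x by (auto simp: subset_iff)
  then show ?case using x by (auto simp: integral_over_def)
next
  case (Cons m ms)
  let ?L = "power_span A x" and ?ns = "ms @ [\<one>]"
  have ns: "set ?ns \<subseteq> carrier R" using Cons.prems(1) by auto
  let ?Sp = "lin_span (?L (d + d)) ?ns"
  have Sp: "submodule_of_ring A ?Sp"
    using submodule_lin_span[OF submodule_power_span _ ns] subringE(1)[OF A] by auto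
  have up: "c \<otimes> t \<in> ?Sp" if "c \<in> insert (x [^] d) (?L d)" "t \<in> lin_span (?L d) ?ns" for c t
  proof (rule lin_span_mult[OF _ _ ns _ that(2)])
    show "c \<in> carrier R" using that(1) x power_span_simps(1)[of d] by auto
    show "c \<otimes> w \<in> ?L (d + d)" if "w \<in> ?L d" for w
      using that \<open>c \<in> insert (x [^] d) (?L d)\<close> power_span_mult_power[of w d d] power_span_mult[of c d w d] by auto
  qed (rule power_span_simps(1))
  \<comment> \<open>This relation says that \<open>x [^] d \<ominus> q\<close> sends
    \<open>m\<close> to \<open>s\<close>. Multiplying the relation
    \<open>x [^] d \<otimes> n = q' \<otimes> m \<oplus> s'\<close> by the same factor therefore
    replaces \<open>q' \<otimes> m\<close> by \<open>q' \<otimes> s\<close>, and \<open>m\<close>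
    disappears.\<close>
  obtain q s where qs: "x [^] d \<otimes> m = q \<otimes> m \<oplus> s" "q \<in> ?L d" "s \<in> lin_span (?L d) ?ns"
    using Cons.prems(2)[of m] by auto
  have "x [^] (d + d) \<otimes> n \<in> ?Sp" if n: "n \<in> set ?ns" for n
  proof -
    obtain q' s' where qs': "x [^] d \<otimes> n = q' \<otimes> m \<oplus> s'" "q' \<in> ?L d" "s' \<in> lin_span (?L d) ?ns"
      using Cons.prems(2)[of n] n by auto
    have c: "n \<in> carrier R" "m \<in> carrier R" "q \<in> carrier R" "q' \<in> carrier R" "s \<in> carrier R"
      "s' \<in> carrier R" "x [^] d \<in> carrier R"
      using n ns Cons.prems(1) qs qs' power_span_simps(1)[of d] x
        lin_span_closed[OF power_span_simps(1)[of d] ns] by (auto simp: subset_iff)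
    have "x [^] (d + d) \<otimes> n = x [^] d \<otimes> (x [^] d \<otimes> n)"
      using c(1,7) x by (simp add: nat_pow_mult[symmetric] m_assoc)
    also have "\<dots> = q' \<otimes> (x [^] d \<otimes> m) \<oplus> x [^] d \<otimes> s'"
      unfolding qs'(1) using c by algebra
    also have "\<dots> = q \<otimes> (q' \<otimes> m \<oplus> s') \<oplus> (\<ominus> q) \<otimes> s' \<oplus> q' \<otimes> s \<oplus> x [^] d \<otimes> s'"
      unfolding qs(1) using c by algebra
    also have "\<dots> = (x [^] d \<otimes> q) \<otimes> n \<oplus> (\<ominus> q) \<otimes> s' \<oplus> q' \<otimes> s \<oplus> x [^] d \<otimes> s'"
      unfolding qs'(1)[symmetric] using c by algebra
    finally have eq: "x [^] (d + d) \<otimes> n = \<dots>" .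
    have "(x [^] d \<otimes> q) \<otimes> n \<in> ?Sp"
      using lin_span_base[OF power_span_mult_power[OF qs(2)] _ _ n ns] power_span_simps(1,2) by simp
    moreover have "(\<ominus> q) \<otimes> s' \<in> ?Sp" "q' \<otimes> s \<in> ?Sp" "x [^] d \<otimes> s' \<in> ?Sp"
      using up qs qs' power_span_uminus by auto
    ultimately show ?thesis
      unfolding eq using Sp by (auto simp: submodule_of_ring_def)
  qed
  then show ?case using Cons.IH[of "d + d"] Cons.prems(1) by auto
qed

end

text \<open>Multiplication by \<open>x\<close> maps \<open>C\<close> to itself, so \<open>x\<close>
  times each generator, and \<open>x\<close> times \<open>\<one>\<close>, is an
  \<open>A\<close>-combination of the generators.\<close>

lemma module_finite_imp_integral:
  assumes A: "subring A R" and C: "subring C R" and fin: "module_finite A C" and x: "x \<in> C"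
  shows "integral_over A x"
proof -
  obtain ms where ms: "set ms \<subseteq> C" "C \<subseteq> lin_span A ms"
    using fin by (auto simp: module_finite_def)
  have xc: "x \<in> carrier R" and msc: "set ms \<subseteq> carrier R" using x ms subringE(1)[OF C] by auto
  note L = power_span_simps[OF A xc] subset_power_span[OF A xc, of 1]
  show ?thesis
  \<comment> \<open>The coefficients are constants from \<open>A\<close>, so the elimination starts
    with \<open>d = 1\<close>. The appended generator \<open>\<one>\<close> gets coefficient
    zero.\<close>
  proof (rule integral_by_elimination[OF A xc msc, of 1])
    fix m assume "m \<in> set (ms @ [\<one>])"
    then have "x \<otimes> m \<in> lin_span A ms" using ms x subringE(3,6)[OF C] by auto
    then have "x \<otimes> m \<in> lin_span (power_span A x 1) ms" using lin_span_mono[OF L(5)] by auto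
    moreover have "\<zero> \<in> lin_span (power_span A x 1) [\<one>]"
      by (rule zero_in_lin_span[OF L(2)]) simp
    ultimately have "x \<otimes> m \<oplus> \<zero> \<in> lin_span (power_span A x 1) (ms @ [\<one>])"
      by (intro lin_span_append[OF L(1) msc]) simp_all
    moreover have "m \<in> carrier R" using \<open>m \<in> set (ms @ [\<one>])\<close> msc by auto
    ultimately show "x [^] (1::nat) \<otimes> m \<in> lin_span (power_span A x 1) (ms @ [\<one>])"
      using xc by simp
  qed
qed

section \<open>Finite generation and adjunction of an element\<close>

lemma lin_span_map_mult:
  assumes "W \<subseteq> carrier R" "set ms \<subseteq> carrier R" "c \<in> carrier R" "s \<in> lin_span W ms"
  shows "s \<otimes> c \<in> lin_span W (map (\<lambda>m. m \<otimes> c) ms)"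
  using assms(2,4)
proof (induction ms arbitrary: s)
  case (Cons m ms)
  then obtain w t where s: "s = w \<otimes> m \<oplus> t" "w \<in> W" "t \<in> lin_span W ms"
    by auto
  have "w \<in> carrier R" "m \<in> carrier R" "t \<in> carrier R"
    using s assms(1) Cons.prems(1) lin_span_closed[OF assms(1), of ms] by auto
  then have "s \<otimes> c = w \<otimes> (m \<otimes> c) \<oplus> t \<otimes> c"
    unfolding s using assms(3) by algebra
  then show ?case using Cons s by auto
qed (use assms(3) in simp)

text \<open>Transitivity of generation: the products of the two lists of generators generate over
  \<open>W\<close>.\<close>

lemma lin_span_lin_span:
  assumes "W \<subseteq> carrier R" "set ms \<subseteq> carrier R" "set ns \<subseteq> carrier R"
    and "s \<in> lin_span (lin_span W ms) ns"
  shows "s \<in> lin_span W (concat (map (\<lambda>n. map (\<lambda>m. m \<otimes> n) ms) ns))"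
  using assms(3,4)
proof (induction ns arbitrary: s)
  case (Cons n ns)
  then obtain w t where s: "s = w \<otimes> n \<oplus> t" "w \<in> lin_span W ms" "t \<in> lin_span (lin_span W ms) ns"
    by auto
  have "set (map (\<lambda>m. m \<otimes> n) ms) \<subseteq> carrier R"
    "set (concat (map (\<lambda>n. map (\<lambda>m. m \<otimes> n) ms) ns)) \<subseteq> carrier R"
    using assms(2) Cons.prems(1) by auto
  then show ?case
    using lin_span_append[OF assms(1) _ _ lin_span_map_mult[OF assms(1,2) _ s(2), of n] Cons.IH[OF _ s(3)]]
      s(1) Cons.prems(1) by auto
qed simp

text \<open>Members of \<open>simple_extension A x\<close> arise by Horner steps
  \<open>y \<otimes> x \<oplus> k\<close>. Sums are formed by peeling off one step from both
  summands, products by induction on the first factor alone.\<close>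

lemma simple_extension_subring:
  assumes A: "subring A R" and x: "x \<in> carrier R"
  shows "subring (simple_extension A x) R"
proof -
  let ?B = "simple_extension A x"
  have B: "?B \<subseteq> carrier R" using simple_extension_in_carrier subringE(1)[OF A] x by auto
  have Ac: "A \<subseteq> carrier R" using subringE(1)[OF A] .
  have AB: "A \<subseteq> ?B" by (rule simple_extension_incl[OF Ac x])
  have add: "y \<oplus> z \<in> ?B" if "y \<in> ?B" "z \<in> ?B" for y z
    using that
  proof (induction arbitrary: z rule: simple_extension.induct)
    case zero
    then show ?case using B by auto
  next
    case (lin y k)
    from lin.prems show ?case
    proof (cases rule: simple_extension.cases)
      case zero
      then show ?thesis using simple_extension.lin[OF lin.hyps] B lin.hyps Ac x by (auto simp: subset_iff)
    next
      case (lin z' k')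
      have "y \<in> carrier R" "z' \<in> carrier R" "k \<in> carrier R" "k' \<in> carrier R"
        using lin \<open>y \<in> ?B\<close> \<open>k \<in> A\<close> B Ac by auto
      then have "(y \<otimes> x \<oplus> k) \<oplus> z = (y \<oplus> z') \<otimes> x \<oplus> (k \<oplus> k')"
        unfolding lin using x by algebra
      then show ?thesis
        using simple_extension.lin[OF \<open>\<And>z. z \<in> ?B \<Longrightarrow> y \<oplus> z \<in> ?B\<close>[OF lin(2)]]
          subringE(7)[OF A \<open>k \<in> A\<close> lin(3)] by simp
    qed
  qed
  have smult: "a \<otimes> y \<in> ?B" if "y \<in> ?B" "a \<in> A" for a y
    using that(1)
  proof (induction rule: simple_extension.induct)
    case zero
    then show ?case using that Ac by auto
  next
    case (lin y k)
    have "y \<in> carrier R" "k \<in> carrier R" "a \<in> carrier R" using lin that B Ac by auto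
    then have "a \<otimes> (y \<otimes> x \<oplus> k) = (a \<otimes> y) \<otimes> x \<oplus> a \<otimes> k" using x by algebra
    then show ?case using simple_extension.lin[OF lin.IH] subringE(6)[OF A that(2) lin.hyps(2)] by simp
  qed
  have gen: "y \<otimes> x \<in> ?B" if "y \<in> ?B" for y
    using simple_extension.lin[OF that subringE(2)[OF A]] that B x by auto
  have mult: "y \<otimes> z \<in> ?B" if "y \<in> ?B" "z \<in> ?B" for y z
    using that(1)
  proof (induction rule: simple_extension.induct)
    case zero
    then show ?case using that B by auto
  next
    case (lin y k)
    have "y \<in> carrier R" "k \<in> carrier R" "z \<in> carrier R" using lin that B Ac by auto
    then have "(y \<otimes> x \<oplus> k) \<otimes> z = (y \<otimes> z) \<otimes> x \<oplus> k \<otimes> z" using x by algebra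
    then show ?case using add gen lin smult that(2) by simp
  qed
  have neg: "\<ominus> y \<in> ?B" if "y \<in> ?B" for y
    using smult[OF that subringE(5)[OF A subringE(3)[OF A]]] that B by (auto simp: l_minus)
  show ?thesis
    by (rule subringI) (use B AB subringE(3)[OF A] neg mult add in auto)
qed

text \<open>A Horner step can overflow only into \<open>x [^] n\<close>, which the relation brings
  back into the span. Positivity of \<open>n\<close> puts the constants there.\<close>

lemma simple_extension_subset_power_span:
  assumes A: "subring A R" and x: "x \<in> carrier R" and n: "0 < n" "x [^] n \<in> power_span A x n"
  shows "simple_extension A x \<subseteq> power_span A x n"
proof
  fix y assume "y \<in> simple_extension A x"
  then show "y \<in> power_span A x n"
  proof (induction rule: simple_extension.induct)
    case zero
    then show ?case by (rule power_span_simps(2)[OF A x])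
  next
    case (lin y k)
    obtain m where m: "n = Suc m" using n(1) by (cases n) auto
    with lin.IH obtain a s where y: "y = a \<otimes> x [^] m \<oplus> s" "a \<in> A" "s \<in> power_span A x m" by auto
    have c: "a \<in> carrier R" "s \<in> carrier R" "x [^] m \<in> carrier R"
      using y subringE(1)[OF A] power_span_simps(1)[OF A x, of m] x by auto
    have "y \<otimes> x = a \<otimes> x [^] n \<oplus> x \<otimes> s"
      unfolding y m nat_pow_Suc using c x by algebra
    moreover have "x \<otimes> s \<in> power_span A x n"
      using power_span_mult_gen[OF A x y(3)] m by simp
    moreover have "k \<in> power_span A x n" using subset_power_span[OF A x n(1)] lin by auto
    ultimately show ?case
      using power_span_simps(3,4)[OF A x] y(2) n(2) by metis
  qed
qed

lemma powers_below_subset_simple_extension: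
  assumes A: "subring A R" and x: "x \<in> carrier R"
  shows "set (powers_below x n) \<subseteq> simple_extension A x"
proof -
  have "x [^] m \<in> simple_extension A x" for m :: nat
    using simple_extension_mem[OF A x] simple_extension_subring[OF A x]
    by (induction m) (auto dest: subringE)
  then show ?thesis by (induction n) auto
qed

lemma module_finite_simple_extension:
  assumes A: "subring A R" and B: "subring B R" and fin: "module_finite A B" and int: "integral_over B x"
  shows "module_finite A (simple_extension B x)"
proof -
  have x: "x \<in> carrier R" using int by (simp add: integral_over_def)
  obtain n where "x [^] n \<in> power_span B x n" using int by (auto simp: integral_over_def)
  \<comment> \<open>Multiplying the relation by \<open>x\<close> makes the exponent
    positive.\<close>
  then have "x [^] Suc n \<in> power_span B x (Suc n)"
    using power_span_mult_gen[OF B x] x by (simp add: m_comm)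
  then have 1: "simple_extension B x \<subseteq> power_span B x (Suc n)"
    by (rule simple_extension_subset_power_span[OF B x zero_less_Suc])
  obtain ms where ms: "set ms \<subseteq> B" "B \<subseteq> lin_span A ms"
    using fin by (auto simp: module_finite_def)
  let ?ps = "powers_below x (Suc n)"
  let ?ns = "concat (map (\<lambda>n. map (\<lambda>m. m \<otimes> n) ms) ?ps)"
  have "set ms \<subseteq> carrier R" using ms subringE(1)[OF B] by auto
  then have "lin_span (lin_span A ms) ?ps \<subseteq> lin_span A ?ns"
    using lin_span_lin_span[OF subringE(1)[OF A] _ powers_below_closed[OF x]] by blast
  then have "simple_extension B x \<subseteq> lin_span A ?ns"
    using 1 lin_span_mono[OF ms(2), of ?ps] by blast
  moreover have "m \<otimes> y \<in> simple_extension B x" if "m \<in> set ms" "y \<in> set ?ps" for m y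
    using that powers_below_subset_simple_extension[OF B x, of "Suc n"] ms(1)
      simple_extension_incl[OF subringE(1)[OF B] x] subringE(6)[OF simple_extension_subring[OF B x]]
    by blast
  then have "set ?ns \<subseteq> simple_extension B x" by auto
  ultimately show ?thesis unfolding module_finite_def by blast
qed

section \<open>Integral elements and the integral closure\<close>

lemma module_finite_refl: "subring A R \<Longrightarrow> module_finite A A"
  unfolding module_finite_def
  by (rule exI[of _ "[\<one>]"]) (use subringE(1,3) in force)

lemma integral_over_mono:
  assumes "integral_over A x" "A \<subseteq> B"
  shows "integral_over B x"
  using assms lin_span_mono[OF assms(2)] by (auto simp: integral_over_def)

lemma integral_over_base:
  assumes "subring A R" "a \<in> A"
  shows "integral_over A a"
  using module_finite_imp_integral[OF assms(1,1) module_finite_refl[OF assms(1)] assms(2)] .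

text \<open>The elements are adjoined one at a time; each is integral over the ring built so far, so
  finiteness over \<open>A\<close> persists.\<close>

lemma module_finite_integral_list:
  assumes A: "subring A R" and "\<And>x. x \<in> set xs \<Longrightarrow> integral_over A x"
  shows "\<exists>C. subring C R \<and> A \<subseteq> C \<and> set xs \<subseteq> C \<and> module_finite A C"
  using assms(2)
proof (induction xs)
  case Nil
  then show ?case using A module_finite_refl by auto
next
  case (Cons x xs)
  then obtain C where C: "subring C R" "A \<subseteq> C" "set xs \<subseteq> C" "module_finite A C" by auto
  have x: "integral_over C x" using Cons.prems integral_over_mono C(2) by auto
  then have xc: "x \<in> carrier R" by (simp add: integral_over_def)
  let ?D = "simple_extension C x"
  have "C \<subseteq> ?D" "x \<in> ?D" "subring ?D R" "module_finite A ?D"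
    using simple_extension_incl[OF subringE(1)[OF C(1)] xc] simple_extension_mem[OF C(1) xc]
      simple_extension_subring[OF C(1) xc] module_finite_simple_extension[OF A C(1,4) x] by auto
  then show ?case using C by (intro exI[of _ ?D]) auto
qed

text \<open>Two integral elements lie in a common module-finite ring, all of whose elements are
  integral.\<close>

lemma integral_closure_is_subring:
  assumes A: "subring A R"
  shows "subring {x. integral_over A x} R"
proof (rule subringI)
  show "{x. integral_over A x} \<subseteq> carrier R" by (auto simp: integral_over_def)
  show "\<one> \<in> {x. integral_over A x}" using integral_over_base[OF A] subringE(3)[OF A] by auto
next
  fix y z assume "y \<in> {x. integral_over A x}" "z \<in> {x. integral_over A x}"
  then obtain C where C: "subring C R" "module_finite A C" "y \<in> C" "z \<in> C"
    using module_finite_integral_list[OF A, of "[y, z]"] by auto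
  then show "y \<otimes> z \<in> {x. integral_over A x}" "y \<oplus> z \<in> {x. integral_over A x}"
    using module_finite_imp_integral[OF A C(1,2)] subringE(6,7)[OF C(1)] by auto
next
  fix y assume "y \<in> {x. integral_over A x}"
  then obtain C where C: "subring C R" "module_finite A C" "y \<in> C"
    using module_finite_integral_list[OF A, of "[y]"] by auto
  then show "\<ominus> y \<in> {x. integral_over A x}"
    using module_finite_imp_integral[OF A C(1,2)] subringE(5)[OF C(1)] by auto
qed

text \<open>A monic equation has finitely many coefficients. They lie in a ring \<open>C\<close>
  finite over \<open>A\<close>, and adjoining \<open>x\<close> to \<open>C\<close> keeps it finite
  over \<open>A\<close>.\<close>

lemma integral_over_trans:
  assumes A: "subring A R" and x: "integral_over {y. integral_over A y} x"
  shows "integral_over A x"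
proof -
  let ?I = "{y. integral_over A y}"
  have I: "subring ?I R" by (rule integral_closure_is_subring[OF A])
  have xc: "x \<in> carrier R" using x by (simp add: integral_over_def)
  obtain n where "x [^] n \<in> power_span ?I x n" using x by (auto simp: integral_over_def)
  then obtain p where p: "set p \<subseteq> ?I" "length p = n" "eval p x = x [^] n"
    unfolding power_span_as_eval[OF I xc] by auto
  then obtain C where C: "subring C R" "A \<subseteq> C" "set p \<subseteq> C" "module_finite A C"
    using module_finite_integral_list[OF A, of p] by auto
  have "x [^] n \<in> power_span C x n"
    unfolding power_span_as_eval[OF C(1) xc] using p C by auto
  then have "integral_over C x" using xc by (auto simp: integral_over_def)
  then show ?thesis
    using module_finite_imp_integral[OF A simple_extension_subring[OF C(1) xc]
        module_finite_simple_extension[OF A C(1,4)] simple_extension_mem[OF C(1) xc]] by auto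
qed

text \<open>Identifies the definition by monic polynomials with the span condition. Elements of
  \<open>A[X]\<close> are lists with nonzero head, so \<open>\<one> \<noteq> \<zero>\<close> is what
  admits \<open>\<one> # q\<close>.\<close>

lemma integral_closure_eq:
  assumes A: "subring A R" and ne: "\<one> \<noteq> \<zero>" and B: "B \<subseteq> carrier R"
  shows "integral_closure R A B = {x \<in> B. integral_over A x}"
proof -
  have "(\<exists>p \<in> carrier (A[X]). p \<noteq> [] \<and> hd p = \<one> \<and> eval p x = \<zero>) \<longleftrightarrow> integral_over A x"
    (is "?l \<longleftrightarrow> _") if "x \<in> B" for x
  proof
    have x: "x \<in> carrier R" using that B by auto
    note L = power_span_as_eval[OF A x]
    {
      assume ?l
      then obtain p where p: "p \<in> carrier (A[X])" "p \<noteq> []" "hd p = \<one>" "eval p x = \<zero>" by auto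
      then obtain q where q: "p = \<one> # q" by (cases p) auto
      then have qA: "set q \<subseteq> A" using p(1) by (auto simp: univ_poly_carrier[symmetric] polynomial_def)
      then have e: "eval q x \<in> power_span A x (length q)" using L by auto
      moreover have "\<one> \<otimes> x [^] length q \<oplus> eval q x = \<zero>" using p q by simp
      ultimately have "x [^] length q = \<ominus> eval q x"
        using x power_span_simps(1)[OF A x] by (auto simp: subset_iff intro: minus_equality[symmetric])
      then show "integral_over A x"
        using power_span_uminus[OF A x e] x unfolding integral_over_def by metis
    next
      assume "integral_over A x"
      then obtain n where "x [^] n \<in> power_span A x n" by (auto simp: integral_over_def)
      then have "\<ominus> (x [^] n) \<in> power_span A x n" by (rule power_span_uminus[OF A x])
      then obtain q where q: "set q \<subseteq> A" "length q = n" "eval q x = \<ominus> (x [^] n)"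
        using L by auto
      then have "\<one> # q \<in> carrier (A[X])"
        using ne subringE(3)[OF A] by (auto simp: univ_poly_carrier[symmetric] polynomial_def)
      moreover have "eval (\<one> # q) x = \<zero>" using q x by (simp add: r_neg)
      ultimately show ?l by force
    }
  qed
  then show ?thesis unfolding integral_closure_def by auto
qed

end

section \<open>Roots of polynomials with a unit coefficient\<close>

definition (in ring) conductor_unit :: "'a set \<Rightarrow> 'a \<Rightarrow> bool" where
  "conductor_unit A t \<longleftrightarrow> (\<exists>a\<in>A. \<exists>b\<in>A. a \<otimes> t \<in> A \<and> b \<otimes> t \<in> A \<and> a \<ominus> b \<otimes> t = \<one>)"

context cring
begin

text \<open>A term \<open>c \<otimes> u [^] k\<close> with \<open>k \<le> n\<close> becomes
  \<open>c \<otimes> d [^] (n - k) \<otimes> (d \<otimes> u) [^] k\<close> after multiplication by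
  \<open>d [^] n\<close>.\<close>

lemma power_scaled_eval:
  assumes A: "subring A R" and d: "d \<in> A" and u: "u \<in> carrier R"
    and p: "set p \<subseteq> A" "length p = Suc n"
  shows "d [^] n \<otimes> eval p u \<in> power_span A (d \<otimes> u) (Suc n)"
  using p
proof (induction n arbitrary: p)
  case 0
  then obtain c where p: "p = [c]" "c \<in> A" by (auto simp: length_Suc_conv)
  then have "d [^] (0::nat) \<otimes> eval p u = c \<otimes> (d \<otimes> u) [^] (0::nat) \<oplus> \<zero>"
    using u subringE(1)[OF A] by auto
  then show ?case using p by auto
next
  case (Suc n)
  then obtain c q where p: "p = c # q" "c \<in> A" "set q \<subseteq> A" "length q = Suc n"
    by (auto simp: length_Suc_conv)
  have du: "d \<otimes> u \<in> carrier R" and cs: "c \<in> carrier R" "d \<in> carrier R" "eval q u \<in> carrier R"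
      "d [^] n \<in> carrier R"
    using d u p subringE(1)[OF A] eval_in_carrier[of q u] by auto
  have "d [^] Suc n \<otimes> eval p u = c \<otimes> (d [^] Suc n \<otimes> u [^] Suc n) \<oplus> d \<otimes> (d [^] n \<otimes> eval q u)"
    using cs u p(1,4) by (simp add: r_distr m_ac)
  also have "d [^] Suc n \<otimes> u [^] Suc n = (d \<otimes> u) [^] Suc n"
    using cs(2) u by (rule pow_mult_distrib[OF m_comm[OF cs(2) u], symmetric])
  finally have "d [^] Suc n \<otimes> eval p u = c \<otimes> (d \<otimes> u) [^] Suc n \<oplus> d \<otimes> (d [^] n \<otimes> eval q u)" .
  moreover have "d \<otimes> (d [^] n \<otimes> eval q u) \<in> power_span A (d \<otimes> u) (Suc n)"
    using power_span_simps(4)[OF A du d Suc.IH[OF p(3,4)]] .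
  ultimately show ?case using p(2) by auto
qed

section \<open>Polynomial relations over an integrally closed subring\<close>

context
  fixes A u
  assumes A: "subring A R" and u: "u \<in> carrier R"
    and closed: "\<And>y. integral_over A y \<Longrightarrow> y \<in> A"
begin

text \<open>Multiplying the equation of degree \<open>Suc n\<close> by \<open>d [^] n\<close> turns
  it into a monic equation for \<open>d \<otimes> u\<close>, which is thus integral and lies in
  \<open>A\<close>.\<close>

lemma leading_coeff_mult_root:
  assumes p: "set (d # p) \<subseteq> A" "eval (d # p) u = \<zero>"
  shows "d \<otimes> u \<in> A"
proof (cases p)
  case Nil
  then have "d = \<zero>" using p subringE(1)[OF A] by auto
  then show ?thesis using u subringE(2)[OF A] by auto
next
  case (Cons c q)
  define n where "n = length q"
  have n: "length p = Suc n" using Cons n_def by simp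
  have d: "d \<in> A" "d \<in> carrier R" and e: "eval p u \<in> carrier R" and du: "d \<otimes> u \<in> carrier R"
    using p subringE(1)[OF A] u eval_in_carrier[of p u] by auto
  have "d \<otimes> u [^] Suc n \<oplus> eval p u = \<zero>" using p(2) n by simp
  then have 1: "d \<otimes> u [^] Suc n = \<ominus> eval p u"
    using d e u by (intro minus_equality[symmetric]) auto
  have "(d \<otimes> u) [^] Suc n = d [^] Suc n \<otimes> u [^] Suc n"
    using d(2) u by (rule pow_mult_distrib[OF m_comm[OF d(2) u]])
  also have "\<dots> = d [^] n \<otimes> (d \<otimes> u [^] Suc n)" using d u by (simp add: m_assoc)
  also have "\<dots> = \<ominus> (d [^] n \<otimes> eval p u)" unfolding 1 using d e by (simp add: r_minus)
  finally have "(d \<otimes> u) [^] Suc n \<in> power_span A (d \<otimes> u) (Suc n)"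
    using power_span_uminus[OF A du power_scaled_eval[OF A d(1) u _ n]] p(1) by auto
  then show ?thesis using closed du unfolding integral_over_def by blast
qed

text \<open>One Horner step merges the first two coefficients \<open>d\<close>, \<open>c'\<close>
  into \<open>d \<otimes> u \<oplus> c'\<close>. This is in \<open>A\<close> by the preceding lemma,
  so the shorter list is again a relation over \<open>A\<close> and the induction continues with
  it.\<close>

lemma coeff_conductor:
  assumes "set (d # p) \<subseteq> A" "eval (d # p) u = \<zero>" "c \<in> set (d # p)"
  shows "\<exists>a\<in>A. \<exists>b\<in>A. a \<otimes> u \<in> A \<and> b \<otimes> u \<in> A \<and> c = a \<ominus> b \<otimes> u"
  using assms
proof (induction p arbitrary: d)
  case Nil
  then have "d \<otimes> u \<in> A" "d \<in> A" "c = d" using leading_coeff_mult_root[of d "[]"] by auto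
  then show ?case
    using subringE(1,2)[OF A] u by (intro bexI[of _ d] bexI[of _ \<zero>]) (auto simp: minus_eq)
next
  case (Cons c' p)
  have du: "d \<otimes> u \<in> A" by (rule leading_coeff_mult_root[of d "c' # p"]) (use Cons.prems in auto)
  let ?e = "d \<otimes> u \<oplus> c'"
  have cs: "d \<in> carrier R" "c' \<in> carrier R" "eval p u \<in> carrier R" "u [^] length p \<in> carrier R"
    using Cons.prems subringE(1)[OF A] u eval_in_carrier[of p u] by auto
  have eA: "set (?e # p) \<subseteq> A" using du Cons.prems subringE(7)[OF A] by auto
  have "eval (?e # p) u = eval (d # c' # p) u"
    using cs u by (simp add: l_distr a_ac) (simp add: m_ac)
  then have e0: "eval (?e # p) u = \<zero>" using Cons.prems(2) by (simp only:)
  have eu: "?e \<otimes> u \<in> A" by (rule leading_coeff_mult_root[OF eA e0])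
  consider "c = d" | "c = c'" | "c \<in> set (?e # p)" using Cons.prems(3) by auto
  then show ?case
  proof cases
    case 1
    then show ?thesis
      using subringE(1,2)[OF A] u du Cons.prems(1)
      by (intro bexI[of _ d] bexI[of _ \<zero>]) (auto simp: minus_eq)
  next
    case 2
    \<comment> \<open>The coefficient swallowed by the merge is recovered from the new leading
      coefficient; both \<open>?e\<close> and \<open>d\<close> multiply \<open>u\<close> into
      \<open>A\<close>.\<close>
    have "c = ?e \<ominus> d \<otimes> u" unfolding 2 using cs u by algebra
    then show ?thesis
      using eu du eA Cons.prems(1) by (intro bexI[of _ ?e] bexI[of _ d]) auto
  next
    case 3
    then show ?thesis by (rule Cons.IH[OF eA e0])
  qed
qed

lemma conductor_unit_of_root:
  assumes p: "set p \<subseteq> A" "eval p u = \<zero>" "\<ominus> \<one> \<in> set p"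
  shows "conductor_unit A u"
proof -
  obtain d q where dq: "p = d # q" using p(3) by (cases p) auto
  obtain a b where ab: "a \<in> A" "b \<in> A" "a \<otimes> u \<in> A" "b \<otimes> u \<in> A" "\<ominus> \<one> = a \<ominus> b \<otimes> u"
    using coeff_conductor[of d q "\<ominus> \<one>"] p unfolding dq by blast
  have c: "a \<in> carrier R" "b \<in> carrier R" using ab subringE(1)[OF A] by auto
  have "\<ominus> a \<ominus> (\<ominus> b) \<otimes> u = \<ominus> (a \<ominus> b \<otimes> u)" using c u by algebra
  also have "\<dots> = \<one>" unfolding ab(5)[symmetric] by simp
  finally have "\<ominus> a \<ominus> (\<ominus> b) \<otimes> u = \<one>" .
  moreover have "(\<ominus> a) \<otimes> u = \<ominus> (a \<otimes> u)" "(\<ominus> b) \<otimes> u = \<ominus> (b \<otimes> u)"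
    using c u by (simp_all add: l_minus)
  ultimately show ?thesis
    unfolding conductor_unit_def using ab subringE(5)[OF A]
    by (intro bexI[of _ "\<ominus> a"] bexI[of _ "\<ominus> b"]) simp_all
qed

lemma simple_extension_eval:
  "y \<in> simple_extension A u \<Longrightarrow> \<exists>p. set p \<subseteq> A \<and> eval p u = y"
proof (induction rule: simple_extension.induct)
  case zero
  show ?case by (rule exI[of _ "[]"]) simp
next
  case (lin y k)
  then obtain p where "set p \<subseteq> A" "eval p u = y" by auto
  then have "set (p @ [k]) \<subseteq> A" "eval (p @ [k]) u = y \<otimes> u \<oplus> k"
    using lin eval_append_aux[of p k u] subringE(1)[OF A] u by auto
  then show ?case by blast
qed

text \<open>Write \<open>u [^] Suc m = w \<otimes> ?v \<oplus> k\<close>. As a polynomial in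
  \<open>u\<close>, the product \<open>w \<otimes> ?v\<close> has only exponents from
  \<open>2 * Suc m\<close> on, so after subtracting the left side the coefficient
  \<open>\<ominus> \<one>\<close> at exponent \<open>Suc m\<close> meets no other term.\<close>

lemma conductor_unit_of_power:
  assumes "u [^] Suc m \<in> simple_extension A (u [^] (2 * Suc m))"
  shows "conductor_unit A u"
proof -
  let ?v = "u [^] (2 * Suc m)"
  have v: "?v \<in> carrier R" using u by simp
  have "\<exists>w\<in>simple_extension A ?v. \<exists>k\<in>A. u [^] Suc m = w \<otimes> ?v \<oplus> k"
    using assms
  proof (cases rule: simple_extension.cases)
    case zero
    have "u [^] Suc m = \<zero> \<otimes> ?v \<oplus> \<zero>" unfolding zero using v by simp
    then show ?thesis using subringE(2)[OF A] by blast
  qed blast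
  then obtain w k where w: "w \<in> simple_extension A ?v" and k: "k \<in> A"
    and eq: "u [^] Suc m = w \<otimes> ?v \<oplus> k"
    by blast
  have sub: "subring (simple_extension A u) R" by (rule simple_extension_subring[OF A u])
  have "u [^] i \<in> simple_extension A u" for i :: nat
    using simple_extension_mem[OF A u] sub by (induction i) (auto dest: subringE)
  then have "simple_extension A ?v \<subseteq> simple_extension A u"
    by (intro simple_extension_subring_incl[OF sub simple_extension_incl[OF subringE(1)[OF A] u]])
  then obtain p where p: "set p \<subseteq> A" "eval p u = w" using w simple_extension_eval by blast
  \<comment> \<open>\<open>?q\<close> lists the coefficients of the polynomial with
    \<open>\<ominus> \<one>\<close> in degree \<open>Suc m\<close> and \<open>k\<close> in degree 0,
    padded to length exactly \<open>2 * Suc m\<close>. Appending it to \<open>p\<close> shifts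
    \<open>p\<close> by that exponent.\<close>
  let ?r = "replicate m \<zero>"
  let ?t = "\<ominus> \<one> # ?r @ [k]"
  let ?q = "?r @ ?t"
  have Ac: "A \<subseteq> carrier R" by (rule subringE(1)[OF A])
  have qA: "set ?q \<subseteq> A" 
  proof -
    have "\<zero> \<in> A" "\<ominus> \<one> \<in> A" using subringE(2,3,5)[OF A] by blast+
    moreover have "set ?q \<subseteq> {\<zero>, \<ominus> \<one>, k}" by (auto simp: set_replicate_conv_if)
    ultimately show ?thesis using k by blast
  qed
  have "eval [k] u = k" using k Ac u by auto
  then have "eval (?r @ [k]) u = k" using eval_replicate[OF _ u, of "[k]" m] k Ac by auto
  then have "eval ?t u = \<ominus> \<one> \<otimes> u [^] Suc m \<oplus> k" by simp
  moreover have "eval ?q u = eval ?t u" by (rule eval_replicate[OF _ u]) (use qA Ac in auto)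
  ultimately have q: "eval ?q u = \<ominus> \<one> \<otimes> u [^] Suc m \<oplus> k" by simp
  have "eval (p @ ?q) u = eval p u \<otimes> u [^] length ?q \<oplus> eval ?q u"
    using p(1) qA Ac by (intro eval_append u) (meson subset_trans)+
  also have "\<dots> = w \<otimes> ?v \<oplus> (\<ominus> \<one> \<otimes> u [^] Suc m \<oplus> k)"
    unfolding q p(2) by (simp add: mult_2)
  also have "\<dots> = (w \<otimes> ?v \<oplus> k) \<ominus> u [^] Suc m"
  proof -
    have "w \<in> carrier R" "k \<in> carrier R" "u [^] Suc m \<in> carrier R"
      using w k Ac u simple_extension_in_carrier[OF Ac v] by auto
    then show ?thesis using v by algebra
  qed
  also have "\<dots> = \<zero>" unfolding eq[symmetric] using u by simp
  finally show ?thesis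
    by (intro conductor_unit_of_root[of "p @ ?q"]) (use p qA in auto)
qed

end
end

section \<open>Flat epimorphisms\<close>

lemma keys_diff_subset:
  "Poly_Mapping.keys u \<subseteq> D \<Longrightarrow> Poly_Mapping.keys v \<subseteq> D \<Longrightarrow> Poly_Mapping.keys (u - v) \<subseteq> D"
  using keys_diff[of u v] by blast

lemmas free_Abelian_group_induction =
  free_Abelian_group_induct[consumes 1, case_names zero diff one]

lemma hom_free_Abelian_group_diff:
  assumes "group G" "f \<in> hom (free_Abelian_group D) G"
    and "Poly_Mapping.keys u \<subseteq> D" "Poly_Mapping.keys v \<subseteq> D"
  shows "f (u - v) = f u \<otimes>\<^bsub>G\<^esub> m_inv G (f v)"
proof -
  interpret group_hom "free_Abelian_group D" G f
    using assms(1,2) by (simp add: group_hom_def group_hom_axioms_def)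
  have "f (u \<otimes>\<^bsub>free_Abelian_group D\<^esub> m_inv (free_Abelian_group D) v) = f u \<otimes>\<^bsub>G\<^esub> m_inv G (f v)"
    using assms(3,4) hom_mult[of u "m_inv (free_Abelian_group D) v"] hom_inv[of v] by simp
  then show ?thesis using assms(4) by simp
qed

text \<open>Agreement is asked only on a part \<open>E\<close> of the basis, because the contraction
  maps below have meaningful values only on part of theirs.\<close>

lemma hom_free_Abelian_group_eq:
  assumes "group G" "f \<in> hom (free_Abelian_group D) G" "g \<in> hom (free_Abelian_group D) G"
    and "Poly_Mapping.keys u \<subseteq> E" "E \<subseteq> D" "\<And>x. x \<in> E \<Longrightarrow> f (frag_of x) = g (frag_of x)"
  shows "f u = g u"
  using assms(4)
proof (induction u rule: free_Abelian_group_induction)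
  case zero
  show ?case
    using hom_one[OF assms(2) _ assms(1)] hom_one[OF assms(3) _ assms(1)] by simp
next
  case (diff u v)
  then show ?case
    using hom_free_Abelian_group_diff[OF assms(1,2), of u v] hom_free_Abelian_group_diff[OF assms(1,3), of u v]
      assms(5) by auto
qed (rule assms(6))

lemma inj_frag_extend:
  assumes "inj_on f (Poly_Mapping.keys u)"
  shows "frag_extend (frag_of \<circ> inv_into (Poly_Mapping.keys u) f) (frag_extend (frag_of \<circ> f) u) = u"
proof -
  have "frag_extend ((frag_of \<circ> inv_into (Poly_Mapping.keys u) f) \<circ> f) u = frag_extend frag_of u"
    by (rule frag_extend_eq) (use assms in simp)
  then show ?thesis by (simp add: frag_extend_compose frag_expansion[symmetric])
qed

section \<open>Pairs of subrings and sets generating the unit ideal\<close>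

locale subring_pair = cring S for S (structure) +
  fixes A T
  assumes subring_A: "subring A S" and subring_T: "subring T S" and A_subset_T: "A \<subseteq> T"
begin

abbreviation Aring :: "('a, 'b) ring_scheme" where
  "Aring \<equiv> S\<lparr>carrier := A\<rparr>"

abbreviation Tmod :: "('a, 'a) module" where
  "Tmod \<equiv> subring_module S T"

lemma T_closed: "t \<in> T \<Longrightarrow> t \<in> carrier S"
  using subringE(1)[OF subring_T] by auto

lemma A_closed: "a \<in> A \<Longrightarrow> a \<in> carrier S"
  using A_subset_T T_closed by auto

lemmas T_ops = subringE(2,3,5-7)[OF subring_T]
lemmas A_ops = subringE(2,3,5-7)[OF subring_A]

lemma Tmod_simps [simp]:
  "carrier Tmod = T" "(\<oplus>\<^bsub>Tmod\<^esub>) = (\<oplus>)" "\<zero>\<^bsub>Tmod\<^esub> = \<zero>" "(\<odot>\<^bsub>Tmod\<^esub>) = (\<otimes>)"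
  by (simp_all add: subring_module_def)

lemma cring_base: "cring Aring"
  using subring_is_ring[OF subring_A] A_closed
  by (intro cring.intro comm_monoid.intro) (auto simp: ring.is_monoid comm_monoid_axioms_def m_comm)

lemma module_Tmod: "module Aring Tmod"
proof -
  have "abelian_group Tmod"
  proof (rule abelian_groupI)
    fix x assume "x \<in> carrier Tmod"
    then show "\<exists>y\<in>carrier Tmod. y \<oplus>\<^bsub>Tmod\<^esub> x = \<zero>\<^bsub>Tmod\<^esub>"
      using T_ops(3)[of x] T_closed[of x] by (intro bexI[of _ "\<ominus> x"]) (auto simp: l_neg)
  qed (use T_ops T_closed in \<open>auto simp: a_ac\<close>)
  then show ?thesis
    using cring_base A_closed T_closed A_subset_T T_ops
    by (auto simp: module_def module_axioms_def l_distr r_distr m_assoc subset_iff)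
qed

abbreviation rels :: "('a, 'p, 'c) module_scheme \<Rightarrow> (('p \<times> 'a) \<Rightarrow>\<^sub>0 int) set" where
  "rels P \<equiv> tensor_relations Aring P Tmod"

text \<open>The action of \<open>T\<close> on the second tensor factor, lifted to formal
  sums.\<close>

definition scale :: "'a \<Rightarrow> (('p \<times> 'a) \<Rightarrow>\<^sub>0 int) \<Rightarrow> (('p \<times> 'a) \<Rightarrow>\<^sub>0 int)" where
  "scale s = frag_extend (\<lambda>(p, t). frag_of (p, s \<otimes> t))"

text \<open>\<open>J\<close> generates the unit ideal of \<open>T\<close>, phrased without the generated ideal so that it can be
  applied to any submodule at hand.\<close>
definition dense :: "'a set \<Rightarrow> bool" where
  "dense J \<longleftrightarrow> (\<forall>K. submodule_of_ring T K \<and> J \<subseteq> K \<longrightarrow> \<one> \<in> K)"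

lemma denseI: "(\<And>K. submodule_of_ring T K \<Longrightarrow> J \<subseteq> K \<Longrightarrow> \<one> \<in> K) \<Longrightarrow> dense J"
  by (auto simp: dense_def)

lemma denseD: "dense J \<Longrightarrow> submodule_of_ring T K \<Longrightarrow> J \<subseteq> K \<Longrightarrow> \<one> \<in> K"
  by (auto simp: dense_def)

lemma dense_mono: "dense J \<Longrightarrow> J \<subseteq> J' \<Longrightarrow> dense J'"
  unfolding dense_def by blast

lemma dense_UNIV: "A \<subseteq> J \<Longrightarrow> dense J"
  using A_ops(2) by (auto intro!: denseI)

lemma submodule_colon:
  assumes K: "submodule_of_ring T K" and c: "c \<in> carrier S"
  shows "submodule_of_ring T {s \<in> carrier S. c \<otimes> s \<in> K}"
  using K c T_closed by (auto simp: submodule_of_ring_def r_distr m_lcomm[of c])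

text \<open>If \<open>K\<close> contains all products, then for fixed \<open>i\<close> the colon
  submodule of \<open>K\<close> by \<open>i\<close> contains \<open>J\<close>, hence
  \<open>\<one>\<close>. So \<open>i \<in> K\<close> for every \<open>i \<in> I\<close>, and density
  of \<open>I\<close> finishes.\<close>

lemma dense_inter:
  assumes I: "dense I" and J: "dense J" and "I \<subseteq> A" "J \<subseteq> A"
    and absorb: "\<And>i j. i \<in> I \<Longrightarrow> j \<in> J \<Longrightarrow> i \<otimes> j \<in> L"
  shows "dense L"
proof (rule denseI)
  fix K assume K: "submodule_of_ring T K" "L \<subseteq> K"
  have "i \<in> K" if "i \<in> I" for i
  proof -
    have ic: "i \<in> carrier S" using that assms(3) A_closed by auto
    have "J \<subseteq> {s \<in> carrier S. i \<otimes> s \<in> K}" using absorb[OF that] K(2) assms(4) A_closed by auto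
    then show ?thesis using denseD[OF J submodule_colon[OF K(1) ic]] ic by auto
  qed
  then show "\<one> \<in> K" using denseD[OF I K(1)] by auto
qed

end

section \<open>Tensor relations and contraction of formal sums\<close>

locale module_over_base = subring_pair S A T + P: module "S\<lparr>carrier := A\<rparr>" P
  for S :: "('a, 'b) ring_scheme" (structure) and A T and P :: "('a, 'p, 'c) module_scheme"
begin

abbreviation freegrp :: "(('p \<times> 'a) \<Rightarrow>\<^sub>0 int) monoid" where
  "freegrp \<equiv> free_Abelian_group (carrier P \<times> T)"

lemma P_smult_closed: "a \<in> A \<Longrightarrow> p \<in> carrier P \<Longrightarrow> a \<odot>\<^bsub>P\<^esub> p \<in> carrier P"
  using P.smult_closed by simp

lemma rels_subgroup: "subgroup (rels P) freegrp"
  unfolding tensor_relations_def Tmod_simps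
proof (rule group.generate_is_subgroup[OF group_free_Abelian_group], intro Un_least subsetI; elim CollectE exE conjE)
  fix u r p t
  assume "u = frag_of (r \<odot>\<^bsub>P\<^esub> p, t) - frag_of (p, r \<otimes> t)" "r \<in> carrier Aring" "p \<in> carrier P" "t \<in> T"
  moreover from this have "r \<odot>\<^bsub>P\<^esub> p \<in> carrier P" "r \<otimes> t \<in> T"
    using P_smult_closed[of r p] A_subset_T T_ops(4)[of r t] by auto
  ultimately show "u \<in> carrier freegrp"
    unfolding carrier_free_Abelian_group_iff by (simp only:, intro keys_diff_subset) auto
qed (use T_ops in \<open>simp_all only: carrier_free_Abelian_group_iff, (intro keys_diff_subset; auto)+\<close>)

lemma rels_zero: "0 \<in> rels P"
  using subgroup.one_closed[OF rels_subgroup] by simp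

lemma rels_keys: "u \<in> rels P \<Longrightarrow> Poly_Mapping.keys u \<subseteq> carrier P \<times> T"
  using subgroup.mem_carrier[OF rels_subgroup] by (simp only: carrier_free_Abelian_group_iff)

lemma rels_add: "u \<in> rels P \<Longrightarrow> v \<in> rels P \<Longrightarrow> u + v \<in> rels P"
  using subgroup.m_closed[OF rels_subgroup] by simp

lemma rels_uminus: "u \<in> rels P \<Longrightarrow> - u \<in> rels P"
  using subgroup.m_inv_closed[OF rels_subgroup, of u] rels_keys by simp

lemma rels_diff: "u \<in> rels P \<Longrightarrow> v \<in> rels P \<Longrightarrow> u - v \<in> rels P"
  using rels_add[of u "- v"] rels_uminus by simp

lemma rels_add_left: "p \<in> carrier P \<Longrightarrow> p' \<in> carrier P \<Longrightarrow> t \<in> T \<Longrightarrow>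
    frag_of (p \<oplus>\<^bsub>P\<^esub> p', t) - frag_of (p, t) - frag_of (p', t) \<in> rels P"
  unfolding tensor_relations_def by (rule generate.incl) auto

lemma rels_add_right: "p \<in> carrier P \<Longrightarrow> t \<in> T \<Longrightarrow> t' \<in> T \<Longrightarrow>
    frag_of (p, t \<oplus> t') - frag_of (p, t) - frag_of (p, t') \<in> rels P"
  unfolding tensor_relations_def by (rule generate.incl) auto

lemma rels_smult: "a \<in> A \<Longrightarrow> p \<in> carrier P \<Longrightarrow> t \<in> T \<Longrightarrow>
    frag_of (a \<odot>\<^bsub>P\<^esub> p, t) - frag_of (p, a \<otimes> t) \<in> rels P"
  unfolding tensor_relations_def by (rule generate.incl) auto

text \<open>The single closure case of differences covers inverses and sums, as
  \<open>h1 + h2 = h1 - (0 - h2)\<close>.\<close>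

lemma rels_induct [consumes 1, case_names zero add_left add_right smult diff]:
  assumes "u \<in> rels P" and "Q 0"
    and "\<And>p p' t. p \<in> carrier P \<Longrightarrow> p' \<in> carrier P \<Longrightarrow> t \<in> T \<Longrightarrow>
      Q (frag_of (p \<oplus>\<^bsub>P\<^esub> p', t) - frag_of (p, t) - frag_of (p', t))"
    and "\<And>p t t'. p \<in> carrier P \<Longrightarrow> t \<in> T \<Longrightarrow> t' \<in> T \<Longrightarrow>
      Q (frag_of (p, t \<oplus> t') - frag_of (p, t) - frag_of (p, t'))"
    and "\<And>a p t. a \<in> A \<Longrightarrow> p \<in> carrier P \<Longrightarrow> t \<in> T \<Longrightarrow>
      Q (frag_of (a \<odot>\<^bsub>P\<^esub> p, t) - frag_of (p, a \<otimes> t))"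
    and diff: "\<And>u v. u \<in> rels P \<Longrightarrow> v \<in> rels P \<Longrightarrow> Q u \<Longrightarrow> Q v \<Longrightarrow> Q (u - v)"
  shows "Q u"
proof -
  define gens where "gens =
     {frag_of (x \<oplus>\<^bsub>P\<^esub> x', y) - frag_of (x, y) - frag_of (x', y) | x x' y.
         x \<in> carrier P \<and> x' \<in> carrier P \<and> y \<in> carrier Tmod} \<union>
      {frag_of (x, y \<oplus>\<^bsub>Tmod\<^esub> y') - frag_of (x, y) - frag_of (x, y') | x y y'.
         x \<in> carrier P \<and> y \<in> carrier Tmod \<and> y' \<in> carrier Tmod} \<union>
      {frag_of (r \<odot>\<^bsub>P\<^esub> x, y) - frag_of (x, r \<odot>\<^bsub>Tmod\<^esub> y) | r x y.
         r \<in> carrier Aring \<and> x \<in> carrier P \<and> y \<in> carrier Tmod}"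
  have rels: "rels P = generate freegrp gens"
    by (simp add: tensor_relations_def gens_def)
  have gen: "Q v" if "v \<in> gens" for v
    using that assms(3-5) unfolding gens_def by auto
  have "u \<in> generate freegrp gens" using assms(1) rels by simp
  then show ?thesis
  proof (induction rule: generate.induct)
    case one
    show ?case using assms(2) by simp
  next
    case (incl h)
    then show ?case by (rule gen)
  next
    case (inv h)
    then have "h \<in> rels P" unfolding rels by (rule generate.incl)
    then show ?case using diff[OF rels_zero _ assms(2) gen[OF inv]] rels_keys by simp
  next
    case (eng h1 h2)
    then have h: "h1 \<in> rels P" "h2 \<in> rels P" using rels by auto
    have "Q (h1 - (0 - h2))"
      by (rule diff[OF h(1) rels_diff[OF rels_zero h(2)] eng(3) diff[OF rels_zero h(2) assms(2) eng(4)]])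
    then show ?case by simp
  qed
qed

lemma scale_frag_of [simp]: "scale s (frag_of (p, t)) = frag_of (p, s \<otimes> t)"
  by (simp add: scale_def)

lemma scale_zero [simp]: "scale s 0 = 0"
  by (simp add: scale_def)

lemma scale_diff [simp]: "scale s (u - v) = scale s u - scale s v"
  by (simp add: scale_def frag_extend_diff)

lemma scale_rels:
  assumes s: "s \<in> T" and "u \<in> rels P"
  shows "scale s u \<in> rels P"
  using assms(2)
proof (induction rule: rels_induct)
  case (add_left p p' t)
  then show ?case using rels_add_left[of p p' "s \<otimes> t"] s T_ops by simp
next
  case (add_right p t t')
  then show ?case
    using rels_add_right[of p "s \<otimes> t" "s \<otimes> t'"] s T_ops T_closed by (simp add: r_distr)
next
  case (smult a p t)
  have "s \<otimes> (a \<otimes> t) = a \<otimes> (s \<otimes> t)"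
    using s smult T_closed A_closed by (simp add: m_lcomm)
  then show ?case using rels_smult[of a p "s \<otimes> t"] s smult T_ops by simp
qed (simp_all add: rels_zero rels_diff)

text \<open>Additivity in the scalar holds only modulo relations: in the free group the sum
  \<open>s \<otimes> t \<oplus> s' \<otimes> t\<close> labels a basis element of its own.\<close>

lemma scale_add_rels:
  assumes s: "s \<in> T" "s' \<in> T" and u: "Poly_Mapping.keys u \<subseteq> carrier P \<times> T"
  shows "scale (s \<oplus> s') u - scale s u - scale s' u \<in> rels P"
  using u
proof (induction u rule: free_Abelian_group_induction)
  case (diff u v)
  have "scale (s \<oplus> s') (u - v) - scale s (u - v) - scale s' (u - v)
      = (scale (s \<oplus> s') u - scale s u - scale s' u) - (scale (s \<oplus> s') v - scale s v - scale s' v)"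
    by simp
  then show ?case using rels_diff[OF diff(3,4)] by (simp only:)
next
  case (one a)
  then obtain p t where a: "a = (p, t)" "p \<in> carrier P" "t \<in> T" by auto
  then show ?case
    using rels_add_right[of p "s \<otimes> t" "s' \<otimes> t"] s T_ops T_closed by (simp add: l_distr)
qed (simp add: rels_zero)

lemma scale_mult:
  assumes s: "s \<in> T" "s' \<in> T" and u: "Poly_Mapping.keys u \<subseteq> carrier P \<times> T"
  shows "scale (s \<otimes> s') u = scale s (scale s' u)"
  using u
proof (induction u rule: free_Abelian_group_induction)
  case (one a)
  then show ?case using s T_closed by (auto simp: m_assoc)
qed simp_all

lemma scale_zero_rels:
  assumes u: "Poly_Mapping.keys u \<subseteq> carrier P \<times> T"
  shows "scale \<zero> u \<in> rels P"
  \<comment> \<open>For two zero scalars the expression collapses to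
    \<open>- scale \<zero> u\<close>.\<close>
  using rels_uminus[OF scale_add_rels[of \<zero> \<zero> u]] u T_ops(1) by simp

lemma scale_one:
  assumes u: "Poly_Mapping.keys u \<subseteq> carrier P \<times> T"
  shows "scale \<one> u = u"
  using u
proof (induction u rule: free_Abelian_group_induction)
  case (one a)
  then show ?case using T_closed by auto
qed simp_all

text \<open>On pairs \<open>(p, t)\<close> with \<open>j t \<in> A\<close> this is \<open>p \<otimes> t \<mapsto> (j t) p\<close>. The value 0 on the other pairs is
  junk, excluded wherever it matters by a condition on the keys.\<close>
definition contract :: "'a \<Rightarrow> (('p \<times> 'a) \<Rightarrow>\<^sub>0 int) \<Rightarrow> 'p" where
  "contract j = (SOME e. e \<in> hom freegrp (add_monoid P) \<and>
     (\<forall>p\<in>carrier P. \<forall>t\<in>T. e (frag_of (p, t)) = (if j \<otimes> t \<in> A then (j \<otimes> t) \<odot>\<^bsub>P\<^esub> p else \<zero>\<^bsub>P\<^esub>)))"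

lemma
  shows contract_hom: "contract j \<in> hom freegrp (add_monoid P)"
    and contract_frag_of: "p \<in> carrier P \<Longrightarrow> t \<in> T \<Longrightarrow>
      contract j (frag_of (p, t)) = (if j \<otimes> t \<in> A then (j \<otimes> t) \<odot>\<^bsub>P\<^esub> p else \<zero>\<^bsub>P\<^esub>)"
proof -
  have "(\<lambda>(p, t). if j \<otimes> t \<in> A then (j \<otimes> t) \<odot>\<^bsub>P\<^esub> p else \<zero>\<^bsub>P\<^esub>) ` (carrier P \<times> T) \<subseteq> carrier (add_monoid P)"
    using P_smult_closed by auto
  then obtain e where "e \<in> hom freegrp (add_monoid P)"
    "\<And>x. x \<in> carrier P \<times> T \<Longrightarrow> e (frag_of x) = (\<lambda>(p, t). if j \<otimes> t \<in> A then (j \<otimes> t) \<odot>\<^bsub>P\<^esub> p else \<zero>\<^bsub>P\<^esub>) x"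
    by (rule comm_group.free_Abelian_group_universal[OF P.a_comm_group]) blast
  then have "\<exists>e. e \<in> hom freegrp (add_monoid P) \<and>
     (\<forall>p\<in>carrier P. \<forall>t\<in>T. e (frag_of (p, t)) = (if j \<otimes> t \<in> A then (j \<otimes> t) \<odot>\<^bsub>P\<^esub> p else \<zero>\<^bsub>P\<^esub>))"
    by (intro exI[of _ e]) simp
  from someI_ex[OF this]
  show "contract j \<in> hom freegrp (add_monoid P)" "p \<in> carrier P \<Longrightarrow> t \<in> T \<Longrightarrow>
      contract j (frag_of (p, t)) = (if j \<otimes> t \<in> A then (j \<otimes> t) \<odot>\<^bsub>P\<^esub> p else \<zero>\<^bsub>P\<^esub>)"
    unfolding contract_def by auto
qed

lemma contract_closed: "Poly_Mapping.keys u \<subseteq> carrier P \<times> T \<Longrightarrow> contract j u \<in> carrier P"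
  using hom_in_carrier[OF contract_hom, of u j] by simp

lemma contract_diff:
  "Poly_Mapping.keys u \<subseteq> carrier P \<times> T \<Longrightarrow> Poly_Mapping.keys v \<subseteq> carrier P \<times> T \<Longrightarrow>
    contract j (u - v) = contract j u \<ominus>\<^bsub>P\<^esub> contract j v"
  using hom_free_Abelian_group_diff[OF P.a_group contract_hom, of u v j]
  by (simp add: a_minus_def a_inv_def)

lemma contract_zero [simp]: "contract j 0 = \<zero>\<^bsub>P\<^esub>"
  using hom_one[OF contract_hom _ P.a_group] by simp

text \<open>It belongs to the formal sum \<open>u\<close>, not to the tensor that \<open>u\<close>
  represents. The condition on the keys keeps the junk value of \<open>contract\<close> out.\<close>

definition annihilator :: "(('p \<times> 'a) \<Rightarrow>\<^sub>0 int) \<Rightarrow> 'a set" where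
  "annihilator u =
     {j \<in> A. Poly_Mapping.keys u \<subseteq> carrier P \<times> {t \<in> T. j \<otimes> t \<in> A} \<and> contract j u = \<zero>\<^bsub>P\<^esub>}"

lemma annihilator_smult:
  assumes a: "a \<in> A" and j: "j \<in> annihilator u"
  shows "a \<otimes> j \<in> annihilator u"
proof -
  have jA: "j \<in> A" and keys: "Poly_Mapping.keys u \<subseteq> carrier P \<times> {t \<in> T. j \<otimes> t \<in> A}"
    and 0: "contract j u = \<zero>\<^bsub>P\<^esub>"
    using j by (auto simp: annihilator_def)
  have eq: "a \<otimes> j \<otimes> t = a \<otimes> (j \<otimes> t)" if "t \<in> T" for t
    using that a jA A_closed T_closed by (simp add: m_assoc)
  have sub: "{t \<in> T. j \<otimes> t \<in> A} \<subseteq> {t \<in> T. a \<otimes> j \<otimes> t \<in> A}"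
    using eq a A_ops by auto
  have keysT: "Poly_Mapping.keys u \<subseteq> carrier P \<times> T" using keys by auto
  have "(\<lambda>p. a \<odot>\<^bsub>P\<^esub> p) \<in> hom (add_monoid P) (add_monoid P)"
    using a P_smult_closed P.smult_r_distr by (auto intro!: homI)
  then have hom: "(\<lambda>p. a \<odot>\<^bsub>P\<^esub> p) \<circ> contract j \<in> hom freegrp (add_monoid P)"
    by (rule hom_compose[OF contract_hom])
  \<comment> \<open>The two homomorphisms may differ on pairs where
    \<open>a \<otimes> j \<otimes> t\<close> is in \<open>A\<close> but \<open>j \<otimes> t\<close>
    is not, so they are compared only on the basis elements with
    \<open>j \<otimes> t \<in> A\<close>, which include all keys of \<open>u\<close>.\<close>
  have "contract (a \<otimes> j) u = ((\<lambda>p. a \<odot>\<^bsub>P\<^esub> p) \<circ> contract j) u"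
  proof (rule hom_free_Abelian_group_eq[OF P.a_group contract_hom hom keys])
    fix x assume "x \<in> carrier P \<times> {t \<in> T. j \<otimes> t \<in> A}"
    then obtain p t where x: "x = (p, t)" "p \<in> carrier P" "t \<in> T" "j \<otimes> t \<in> A" by auto
    then have "a \<otimes> (j \<otimes> t) \<in> A" using A_ops a by auto
    then show "contract (a \<otimes> j) (frag_of x) = ((\<lambda>p. a \<odot>\<^bsub>P\<^esub> p) \<circ> contract j) (frag_of x)"
      using x a eq[of t] P.smult_assoc1[of a "j \<otimes> t" p] by (simp add: contract_frag_of)
  qed auto
  also have "\<dots> = \<zero>\<^bsub>P\<^esub>" using 0 a P.smult_r_null by simp
  finally show ?thesis
    using keys sub a jA A_ops unfolding annihilator_def by blast
qed

text \<open>Moving \<open>j \<otimes> t \<in> A\<close> across the tensor sign turns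
  \<open>j\<close> times \<open>u\<close> into \<open>contract j u\<close> tensored with
  \<open>\<one>\<close>.\<close>

lemma contract_rels:
  assumes j: "j \<in> A" and u: "Poly_Mapping.keys u \<subseteq> carrier P \<times> {t \<in> T. j \<otimes> t \<in> A}"
  shows "scale j u - frag_of (contract j u, \<one>) \<in> rels P"
  using u
proof (induction u rule: free_Abelian_group_induction)
  case zero
  \<comment> \<open>The additivity relation for zero plus zero is exactly the negative of the basis
    element needed here.\<close>
  show ?case
    using rels_add_left[of "\<zero>\<^bsub>P\<^esub>" "\<zero>\<^bsub>P\<^esub>" \<one>] T_ops(2) by simp
next
  case (diff u v)
  let ?p = "contract j u" and ?q = "contract j v"
  have k: "Poly_Mapping.keys u \<subseteq> carrier P \<times> T" "Poly_Mapping.keys v \<subseteq> carrier P \<times> T"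
    using diff by auto
  have c: "?p \<in> carrier P" "?q \<in> carrier P" using contract_closed k by auto
  then have "(?p \<ominus>\<^bsub>P\<^esub> ?q) \<oplus>\<^bsub>P\<^esub> ?q = ?p" by (simp add: a_minus_def P.a_assoc P.l_neg)
  then have 1: "frag_of (?p, \<one>) - frag_of (?p \<ominus>\<^bsub>P\<^esub> ?q, \<one>) - frag_of (?q, \<one>) \<in> rels P"
    using rels_add_left[of "?p \<ominus>\<^bsub>P\<^esub> ?q" ?q \<one>] c T_ops(2) by simp
  have "scale j (u - v) - frag_of (contract j (u - v), \<one>)
      = ((scale j u - frag_of (?p, \<one>)) - (scale j v - frag_of (?q, \<one>)))
        + (frag_of (?p, \<one>) - frag_of (?p \<ominus>\<^bsub>P\<^esub> ?q, \<one>) - frag_of (?q, \<one>))"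
    using k by (simp add: contract_diff)
  then show ?case using rels_add[OF rels_diff[OF diff(3,4)] 1] by (simp only:)
next
  case (one a)
  then obtain p t where a: "a = (p, t)" "p \<in> carrier P" "t \<in> T" "j \<otimes> t \<in> A" by auto
  then show ?case
    using rels_uminus[OF rels_smult[of "j \<otimes> t" p \<one>]] T_ops(2) A_closed
    by (simp add: contract_frag_of)
qed

text \<open>The scalars that send \<open>u\<close> into the relations form a
  \<open>T\<close>-submodule. By \<open>contract_rels\<close> it contains the annihilator, hence by
  density also \<open>\<one>\<close>.\<close>

lemma rels_if_dense:
  assumes u: "Poly_Mapping.keys u \<subseteq> carrier P \<times> T" and dense: "dense (annihilator u)"
  shows "u \<in> rels P"
proof -
  let ?K = "{s \<in> T. scale s u \<in> rels P}"
  have "submodule_of_ring T ?K"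
    unfolding submodule_of_ring_def
  proof (intro conjI ballI)
    show "?K \<subseteq> carrier S" using T_closed by auto
    show "\<zero> \<in> ?K" using T_ops(1) scale_zero_rels[OF u] by simp
    fix s s' assume s: "s \<in> ?K" "s' \<in> ?K"
    have "(scale (s \<oplus> s') u - scale s u - scale s' u) + scale s u + scale s' u \<in> rels P"
      using s scale_add_rels[OF _ _ u] by (intro rels_add) auto
    then show "s \<oplus> s' \<in> ?K" using s T_ops by simp
  next
    fix a s assume s: "a \<in> T" "s \<in> ?K"
    then show "a \<otimes> s \<in> ?K" using scale_mult[of a s u] scale_rels u T_ops by simp
  qed
  moreover have "annihilator u \<subseteq> ?K"
  proof
    fix j assume j: "j \<in> annihilator u"
    then have "scale j u - frag_of (\<zero>\<^bsub>P\<^esub>, \<one>) \<in> rels P"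
      using contract_rels[of j u] by (auto simp: annihilator_def)
    moreover have "frag_of (\<zero>\<^bsub>P\<^esub>, \<one>) \<in> rels P"
      using rels_uminus[OF rels_add_left[of "\<zero>\<^bsub>P\<^esub>" "\<zero>\<^bsub>P\<^esub>" \<one>]] T_ops(2) by simp
    ultimately have "scale j u - frag_of (\<zero>\<^bsub>P\<^esub>, \<one>) + frag_of (\<zero>\<^bsub>P\<^esub>, \<one>) \<in> rels P"
      by (rule rels_add)
    then show "j \<in> ?K" using j A_subset_T by (auto simp: annihilator_def)
  qed
  ultimately have "\<one> \<in> ?K" by (rule denseD[OF dense])
  then show ?thesis using scale_one[OF u] by simp
qed

end

section \<open>Conductors generating the unit ideal\<close>

locale flat_pair = subring_pair S A T for S (structure) and A T +
  assumes conductor_unit: "t \<in> T \<Longrightarrow> conductor_unit A t"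
begin

lemma dense_conductor:
  assumes t: "t \<in> T"
  shows "dense {j \<in> A. j \<otimes> t \<in> A}"
proof (rule denseI)
  fix K assume K: "submodule_of_ring T K" "{j \<in> A. j \<otimes> t \<in> A} \<subseteq> K"
  obtain a b where ab: "a \<in> A" "b \<in> A" "a \<otimes> t \<in> A" "b \<otimes> t \<in> A" "a \<ominus> b \<otimes> t = \<one>"
    using conductor_unit[OF t] by (auto simp: conductor_unit_def)
  then have "a \<in> K" "b \<in> K" using K(2) by auto
  then have "a \<oplus> (\<ominus> t) \<otimes> b \<in> K" using K(1) T_ops(3)[OF t] by (auto simp: submodule_of_ring_def)
  moreover have "a \<oplus> (\<ominus> t) \<otimes> b = a \<ominus> b \<otimes> t"
    using ab A_closed T_closed[OF t] by (simp add: a_minus_def l_minus r_minus m_comm)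
  ultimately show "\<one> \<in> K" using ab by simp
qed

text \<open>For \<open>a\<close> with \<open>a \<otimes> y \<in> A\<close>, both maps agree on
  \<open>a\<close> and on \<open>a \<otimes> y\<close>, so the image of \<open>a\<close> kills the
  difference \<open>d\<close> of the images of \<open>y\<close>. Such \<open>a\<close> generate the
  unit ideal, hence \<open>d\<close> vanishes.\<close>

lemma epimorphism: "cring_epimorphism U Aring (S\<lparr>carrier := T\<rparr>) (\<lambda>x. x)"
  unfolding cring_epimorphism_def
proof (intro conjI allI impI ballI)
  show "(\<lambda>x. x) \<in> ring_hom Aring (S\<lparr>carrier := T\<rparr>)"
    using A_subset_T by (auto simp: ring_hom_def)
next
  fix C :: "'c ring" and g h y
  assume C: "cring C" and g: "g \<in> ring_hom (S\<lparr>carrier := T\<rparr>) C"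
    and h: "h \<in> ring_hom (S\<lparr>carrier := T\<rparr>) C" and gh: "\<forall>x\<in>carrier Aring. g x = h x"
    and y: "y \<in> carrier (S\<lparr>carrier := T\<rparr>)"
  interpret C: cring C by (rule C)
  have gc: "\<And>x. x \<in> T \<Longrightarrow> g x \<in> carrier C" and hc: "\<And>x. x \<in> T \<Longrightarrow> h x \<in> carrier C"
    using ring_hom_closed[OF g] ring_hom_closed[OF h] by auto
  have gm: "\<And>x z. x \<in> T \<Longrightarrow> z \<in> T \<Longrightarrow> g (x \<otimes> z) = g x \<otimes>\<^bsub>C\<^esub> g z"
    and hm: "\<And>x z. x \<in> T \<Longrightarrow> z \<in> T \<Longrightarrow> h (x \<otimes> z) = h x \<otimes>\<^bsub>C\<^esub> h z"
    and ga: "\<And>x z. x \<in> T \<Longrightarrow> z \<in> T \<Longrightarrow> g (x \<oplus> z) = g x \<oplus>\<^bsub>C\<^esub> g z"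
    using ring_hom_mult[OF g] ring_hom_mult[OF h] ring_hom_add[OF g] by auto
  have y: "y \<in> T" using y by simp
  define d where "d = g y \<ominus>\<^bsub>C\<^esub> h y"
  have d: "d \<in> carrier C" using y gc hc by (simp add: d_def)
  have kill: "g a \<otimes>\<^bsub>C\<^esub> d = \<zero>\<^bsub>C\<^esub>" if "a \<in> A" "a \<otimes> y \<in> A" for a
  proof -
    have "a \<in> T" using that A_subset_T by auto
    then have "g a \<otimes>\<^bsub>C\<^esub> g y = g a \<otimes>\<^bsub>C\<^esub> h y"
      using gm[of a y] hm[of a y] gh that y by simp
    then show ?thesis
      using \<open>a \<in> T\<close> y gc hc by (simp add: d_def C.minus_eq C.r_distr C.r_minus C.r_neg)
  qed
  obtain a b where ab: "a \<in> A" "b \<in> A" "a \<otimes> y \<in> A" "b \<otimes> y \<in> A" "a \<ominus> b \<otimes> y = \<one>"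
    using conductor_unit[OF y] by (auto simp: conductor_unit_def)
  have abT: "a \<in> T" "b \<in> T" "\<ominus> y \<in> T" using ab A_subset_T y T_ops by auto
  have "\<one> = a \<oplus> (\<ominus> y) \<otimes> b"
    using ab A_closed T_closed[OF y] by (simp add: a_minus_def l_minus r_minus m_comm)
  then have one: "\<one>\<^bsub>C\<^esub> = g a \<oplus>\<^bsub>C\<^esub> g (\<ominus> y) \<otimes>\<^bsub>C\<^esub> g b"
    using ring_hom_one[OF g] abT T_ops by (simp add: ga gm)
  have "d = (g a \<oplus>\<^bsub>C\<^esub> g (\<ominus> y) \<otimes>\<^bsub>C\<^esub> g b) \<otimes>\<^bsub>C\<^esub> d"
    unfolding one[symmetric] using d by simp
  also have "\<dots> = g a \<otimes>\<^bsub>C\<^esub> d \<oplus>\<^bsub>C\<^esub> g (\<ominus> y) \<otimes>\<^bsub>C\<^esub> (g b \<otimes>\<^bsub>C\<^esub> d)"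
    using abT gc d by (simp add: C.l_distr C.m_assoc)
  also have "\<dots> = \<zero>\<^bsub>C\<^esub>" using kill ab abT gc by simp
  finally have "g y \<ominus>\<^bsub>C\<^esub> h y = \<zero>\<^bsub>C\<^esub>" by (simp add: d_def)
  then show "g y = h y" using y gc hc by (simp add: C.r_right_minus_eq)
qed

end

locale flat_module_over_base = flat_pair S A T + module_over_base S A T P
  for S :: "('a, 'b) ring_scheme" (structure) and A T and P :: "('a, 'p, 'c) module_scheme"
begin

text \<open>A generating relation with a single entry \<open>t\<close> is annihilated by every
  \<open>j\<close> in the conductor of \<open>t\<close>. Relations with two entries, and
  differences, use products from two dense sets and \<open>dense_inter\<close>.\<close>

lemma annihilator_dense:
  assumes "u \<in> rels P"
  shows "dense (annihilator u)"
  using assms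
proof (induction rule: rels_induct)
  case zero
  have "A \<subseteq> annihilator 0" by (auto simp: annihilator_def)
  then show ?case by (rule dense_UNIV)
next
  case (add_left p p' t)
  show ?case
  proof (rule dense_mono[OF dense_conductor[OF add_left(3)]], rule subsetI)
    fix j assume j: "j \<in> {j \<in> A. j \<otimes> t \<in> A}"
    let ?u = "frag_of (p \<oplus>\<^bsub>P\<^esub> p', t) - frag_of (p, t) - frag_of (p', t)"
    have "Poly_Mapping.keys ?u \<subseteq> carrier P \<times> {t \<in> T. j \<otimes> t \<in> A}"
      using j add_left by (intro keys_diff_subset) auto
    moreover have "contract j ?u = \<zero>\<^bsub>P\<^esub>"
    proof -
      let ?x = "(j \<otimes> t) \<odot>\<^bsub>P\<^esub> p" and ?y = "(j \<otimes> t) \<odot>\<^bsub>P\<^esub> p'"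
      have c: "?x \<in> carrier P" "?y \<in> carrier P" using j add_left P_smult_closed by auto
      have "contract j ?u = contract j (frag_of (p \<oplus>\<^bsub>P\<^esub> p', t)) \<ominus>\<^bsub>P\<^esub> contract j (frag_of (p, t)) \<ominus>\<^bsub>P\<^esub> contract j (frag_of (p', t))"
        using add_left by (simp add: contract_diff keys_diff_subset)
      also have "\<dots> = (?x \<oplus>\<^bsub>P\<^esub> ?y) \<ominus>\<^bsub>P\<^esub> ?x \<ominus>\<^bsub>P\<^esub> ?y"
        using j add_left P.smult_r_distr[of "j \<otimes> t" p p'] by (simp add: contract_frag_of)
      also have "\<dots> = \<zero>\<^bsub>P\<^esub>"
        using c by (simp add: P.minus_eq P.a_ac P.r_neg P.r_neg1 P.r_neg2)
      finally show ?thesis .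
    qed
    ultimately show "j \<in> annihilator ?u" using j by (simp add: annihilator_def)
  qed
next
  case (add_right p t t')
  show ?case
  proof (rule dense_inter[OF dense_conductor[OF add_right(2)] dense_conductor[OF add_right(3)]])
    fix i k assume ik: "i \<in> {j \<in> A. j \<otimes> t \<in> A}" "k \<in> {j \<in> A. j \<otimes> t' \<in> A}"
    \<comment> \<open>The product moves \<open>t\<close>, \<open>t'\<close> and therefore their sum
      into \<open>A\<close>.\<close>
    define j where "j = i \<otimes> k"
    have cs: "i \<in> carrier S" "k \<in> carrier S" "t \<in> carrier S" "t' \<in> carrier S"
      using ik add_right A_closed T_closed by auto
    have "j \<otimes> t = k \<otimes> (i \<otimes> t)" "j \<otimes> t' = i \<otimes> (k \<otimes> t')"
      unfolding j_def using cs by (simp_all add: m_ac)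
    then have jA: "j \<in> A" "j \<otimes> t \<in> A" "j \<otimes> t' \<in> A"
      using ik A_ops by (auto simp: j_def)
    have eq: "j \<otimes> (t \<oplus> t') = j \<otimes> t \<oplus> j \<otimes> t'"
      using cs by (simp add: j_def r_distr)
    let ?u = "frag_of (p, t \<oplus> t') - frag_of (p, t) - frag_of (p, t')"
    have "Poly_Mapping.keys ?u \<subseteq> carrier P \<times> {t \<in> T. j \<otimes> t \<in> A}"
      using jA eq add_right A_ops T_ops by (intro keys_diff_subset) auto
    moreover have "contract j ?u = \<zero>\<^bsub>P\<^esub>"
    proof -
      let ?x = "(j \<otimes> t) \<odot>\<^bsub>P\<^esub> p" and ?y = "(j \<otimes> t') \<odot>\<^bsub>P\<^esub> p"
      have c: "?x \<in> carrier P" "?y \<in> carrier P" using jA add_right P_smult_closed by auto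
      have "contract j ?u = contract j (frag_of (p, t \<oplus> t')) \<ominus>\<^bsub>P\<^esub> contract j (frag_of (p, t)) \<ominus>\<^bsub>P\<^esub> contract j (frag_of (p, t'))"
        using add_right T_ops by (simp add: contract_diff keys_diff_subset)
      also have "\<dots> = (?x \<oplus>\<^bsub>P\<^esub> ?y) \<ominus>\<^bsub>P\<^esub> ?x \<ominus>\<^bsub>P\<^esub> ?y"
        using jA eq add_right A_ops T_ops P.smult_l_distr[of "j \<otimes> t" "j \<otimes> t'" p] by (simp add: contract_frag_of)
      also have "\<dots> = \<zero>\<^bsub>P\<^esub>"
        using c by (simp add: P.minus_eq P.a_ac P.r_neg P.r_neg1 P.r_neg2)
      finally show ?thesis .
    qed
    ultimately show "i \<otimes> k \<in> annihilator ?u" using jA by (simp add: annihilator_def j_def)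
  qed auto
next
  case (smult a p t)
  show ?case
  proof (rule dense_mono[OF dense_conductor[OF smult(3)]], rule subsetI)
    fix j assume j: "j \<in> {j \<in> A. j \<otimes> t \<in> A}"
    let ?u = "frag_of (a \<odot>\<^bsub>P\<^esub> p, t) - frag_of (p, a \<otimes> t)"
    have aT: "a \<otimes> t \<in> T" using smult A_subset_T T_ops by auto
    have eq: "j \<otimes> (a \<otimes> t) = (j \<otimes> t) \<otimes> a"
      using j smult A_closed T_closed by (simp add: m_ac)
    then have jA: "j \<otimes> (a \<otimes> t) \<in> A" using j smult A_ops by auto
    have "Poly_Mapping.keys ?u \<subseteq> carrier P \<times> {t \<in> T. j \<otimes> t \<in> A}"
      using j jA aT smult P_smult_closed by (intro keys_diff_subset) auto
    moreover have "contract j ?u = contract j (frag_of (a \<odot>\<^bsub>P\<^esub> p, t)) \<ominus>\<^bsub>P\<^esub> contract j (frag_of (p, a \<otimes> t))"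
      using smult aT P_smult_closed by (intro contract_diff) auto
    then have "contract j ?u = \<zero>\<^bsub>P\<^esub>"
      using j jA aT smult eq P.smult_assoc1[of "j \<otimes> t" a p] P_smult_closed
      by (simp add: contract_frag_of P.minus_eq P.r_neg)
    ultimately show "j \<in> annihilator ?u" using j by (simp add: annihilator_def)
  qed
next
  case (diff u v)
  show ?case
  proof (rule dense_inter[OF diff(3,4)])
    fix i k assume ik: "i \<in> annihilator u" "k \<in> annihilator v"
    then have A: "i \<in> A" "k \<in> A" by (auto simp: annihilator_def)
    \<comment> \<open>Annihilators absorb factors from \<open>A\<close>, so the product lies in both
      of them.\<close>
    then have "k \<otimes> i \<in> annihilator u" "i \<otimes> k \<in> annihilator v" using ik annihilator_smult by auto
    moreover have "k \<otimes> i = i \<otimes> k" using A A_closed m_comm by simp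
    ultimately have *: "i \<otimes> k \<in> annihilator u" "i \<otimes> k \<in> annihilator v" by auto
    have "Poly_Mapping.keys (u - v) \<subseteq> carrier P \<times> {t \<in> T. i \<otimes> k \<otimes> t \<in> A}"
      using * keys_diff[of u v] unfolding annihilator_def by blast
    then show "i \<otimes> k \<in> annihilator (u - v)"
      using * contract_diff[OF rels_keys[OF diff(1)] rels_keys[OF diff(2)], of "i \<otimes> k"]
      by (simp add: annihilator_def P.minus_eq)
  qed (auto simp: annihilator_def)
qed

lemma rels_iff_dense:
  "Poly_Mapping.keys u \<subseteq> carrier P \<times> T \<Longrightarrow> u \<in> rels P \<longleftrightarrow> dense (annihilator u)"
  using rels_if_dense annihilator_dense by blast

end

text \<open>An injective relabelling causes no cancellation. The nontrivial inclusion comes from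
  relabelling back with \<open>inj_frag_extend\<close>.\<close>

lemma keys_frag_extend_inj:
  assumes "inj_on f (Poly_Mapping.keys u)"
  shows "Poly_Mapping.keys (frag_extend (frag_of \<circ> f) u) = f ` Poly_Mapping.keys u"
proof
  show sub: "Poly_Mapping.keys (frag_extend (frag_of \<circ> f) u) \<subseteq> f ` Poly_Mapping.keys u"
    using keys_frag_extend[of "frag_of \<circ> f" u] by auto
  let ?g = "inv_into (Poly_Mapping.keys u) f"
  have "Poly_Mapping.keys u \<subseteq> ?g ` Poly_Mapping.keys (frag_extend (frag_of \<circ> f) u)"
    using keys_frag_extend[of "frag_of \<circ> ?g" "frag_extend (frag_of \<circ> f) u"]
    unfolding inj_frag_extend[OF assms] by auto
  then show "f ` Poly_Mapping.keys u \<subseteq> Poly_Mapping.keys (frag_extend (frag_of \<circ> f) u)"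
    using sub by (force simp: f_inv_into_f)
qed

lemma (in group) rcoset_eq_iff:
  assumes "subgroup H G" "x \<in> carrier G" "y \<in> carrier G"
  shows "H #> x = H #> y \<longleftrightarrow> x \<otimes> inv y \<in> H"
  using assms by (metis rcos_self repr_independence subgroup.rcos_module is_group)

section \<open>Injective module maps and flatness\<close>

context flat_pair
begin

context
  fixes P :: "('a, 'p, 'c) module_scheme" and Q :: "('a, 'q, 'd) module_scheme" and h
  assumes P: "module Aring P" and Q: "module Aring Q"
    and h: "h \<in> module_homs Aring P Q" and inj: "inj_on h (carrier P)"
begin

interpretation P: flat_module_over_base S A T P
  by (intro flat_module_over_base.intro module_over_base.intro P flat_pair_axioms subring_pair_axioms)

interpretation Q: flat_module_over_base S A T Q
  by (intro flat_module_over_base.intro module_over_base.intro Q flat_pair_axioms subring_pair_axioms)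

abbreviation h_map where
  "h_map \<equiv> frag_extend (\<lambda>(x, y). frag_of (h x, y))"

lemma h_hom: "h \<in> hom (add_monoid P) (add_monoid Q)"
  and h_smult: "a \<in> A \<Longrightarrow> p \<in> carrier P \<Longrightarrow> h (a \<odot>\<^bsub>P\<^esub> p) = a \<odot>\<^bsub>Q\<^esub> h p"
  and h_closed: "p \<in> carrier P \<Longrightarrow> h p \<in> carrier Q"
  using h by (auto simp: module_homs_def hom_def)

lemma h_zero: "h \<zero>\<^bsub>P\<^esub> = \<zero>\<^bsub>Q\<^esub>"
  using hom_one[OF h_hom P.P.a_group Q.P.a_group] by simp

lemma keys_h_map:
  assumes "Poly_Mapping.keys u \<subseteq> carrier P \<times> T"
  shows "Poly_Mapping.keys (h_map u) = (\<lambda>(x, y). (h x, y)) ` Poly_Mapping.keys u"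
proof -
  have "(\<lambda>(x, y). frag_of (h x, y)) = frag_of \<circ> (\<lambda>(x, y). (h x, y))" by auto
  moreover have "inj_on (\<lambda>(x, y). (h x, y)) (Poly_Mapping.keys u)"
    using inj assms by (auto simp: inj_on_def subset_iff)
  ultimately show ?thesis using keys_frag_extend_inj by metis
qed

lemma h_map_closed: "Poly_Mapping.keys u \<subseteq> carrier P \<times> T \<Longrightarrow> Poly_Mapping.keys (h_map u) \<subseteq> carrier Q \<times> T"
  using keys_h_map[of u] h_closed by auto

text \<open>The two sides agree on basis elements by linearity of \<open>h\<close>, and on the junk
  pairs because \<open>h\<close> preserves zero.\<close>

lemma contract_h_map:
  assumes u: "Poly_Mapping.keys u \<subseteq> carrier P \<times> T"
  shows "Q.contract j (h_map u) = h (P.contract j u)"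
proof -
  have 1: "h_map \<in> hom P.freegrp Q.freegrp"
  proof (rule homI)
    fix u v assume "u \<in> carrier P.freegrp"
    then show "h_map u \<in> carrier Q.freegrp" using h_map_closed by (simp only: carrier_free_Abelian_group_iff)
  qed (simp add: frag_extend_add)
  have "(Q.contract j \<circ> h_map) u = (h \<circ> P.contract j) u"
  proof (rule hom_free_Abelian_group_eq[OF Q.P.a_group hom_compose[OF 1 Q.contract_hom]
        hom_compose[OF P.contract_hom h_hom] u order.refl])
    fix x assume "x \<in> carrier P \<times> T"
    then show "(Q.contract j \<circ> h_map) (frag_of x) = (h \<circ> P.contract j) (frag_of x)"
      using h_closed by (auto simp: P.contract_frag_of Q.contract_frag_of h_smult h_zero)
  qed
  then show ?thesis by simp
qed

text \<open>Here injectivity of \<open>h\<close> enters: it keeps the second components of the keys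
  unchanged and lets \<open>h\<close> of the contraction vanish only if the contraction
  does.\<close>

lemma annihilator_h_map:
  assumes u: "Poly_Mapping.keys u \<subseteq> carrier P \<times> T"
  shows "Q.annihilator (h_map u) = P.annihilator u"
proof -
  have "Poly_Mapping.keys (h_map u) \<subseteq> carrier Q \<times> {t \<in> T. j \<otimes> t \<in> A} \<longleftrightarrow>
      Poly_Mapping.keys u \<subseteq> carrier P \<times> {t \<in> T. j \<otimes> t \<in> A}" for j
  proof -
    have "(h p, t) \<in> carrier Q \<times> {t \<in> T. j \<otimes> t \<in> A} \<longleftrightarrow> (p, t) \<in> carrier P \<times> {t \<in> T. j \<otimes> t \<in> A}"
      if "(p, t) \<in> Poly_Mapping.keys u" for p t
    proof -
      have "p \<in> carrier P" using that u by blast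
      then show ?thesis using h_closed by simp
    qed
    then show ?thesis
      unfolding keys_h_map[OF u] image_subset_iff subset_iff[of "Poly_Mapping.keys u"]
      by (metis (no_types, lifting) case_prod_conv surj_pair)
  qed
  moreover have "Q.contract j (h_map u) = \<zero>\<^bsub>Q\<^esub> \<longleftrightarrow> P.contract j u = \<zero>\<^bsub>P\<^esub>" for j
    unfolding contract_h_map[OF u]
    using inj_onD[OF inj, of "P.contract j u" "\<zero>\<^bsub>P\<^esub>"] h_zero P.contract_closed[OF u] by auto
  ultimately show ?thesis unfolding P.annihilator_def Q.annihilator_def by simp
qed

text \<open>From left to right this is flatness on formal sums; from right to left it makes the
  induced map well defined.\<close>

lemma h_map_rels_iff:
  assumes u: "Poly_Mapping.keys u \<subseteq> carrier P \<times> T"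
  shows "h_map u \<in> rels Q \<longleftrightarrow> u \<in> rels P"
  using P.rels_iff_dense[OF u] Q.rels_iff_dense[OF h_map_closed[OF u]] annihilator_h_map[OF u] by simp

lemma rcoset_rels_eq_iff:
  assumes "Poly_Mapping.keys u \<subseteq> carrier Q \<times> T" "Poly_Mapping.keys v \<subseteq> carrier Q \<times> T"
  shows "rels Q #>\<^bsub>Q.freegrp\<^esub> u = rels Q #>\<^bsub>Q.freegrp\<^esub> v \<longleftrightarrow> u - v \<in> rels Q"
  using group.rcoset_eq_iff[OF group_free_Abelian_group Q.rels_subgroup, of u v] assms by simp

text \<open>All representatives of a coset have images in one coset, so \<open>the_elem\<close> is
  applied to a singleton.\<close>

lemma tensor_map_rcoset:
  assumes u: "Poly_Mapping.keys u \<subseteq> carrier P \<times> T"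
  shows "tensor_map Aring Q Tmod h (rels P #>\<^bsub>P.freegrp\<^esub> u) = rels Q #>\<^bsub>Q.freegrp\<^esub> h_map u"
proof -
  let ?f = "\<lambda>v. rels Q #>\<^bsub>Q.freegrp\<^esub> h_map v"
  have "?f v = ?f u" if v: "v \<in> rels P #>\<^bsub>P.freegrp\<^esub> u" for v
  proof -
    obtain w where w: "w \<in> rels P" "v = w + u" using v by (auto simp: r_coset_def)
    have wk: "Poly_Mapping.keys w \<subseteq> carrier P \<times> T" by (rule P.rels_keys[OF w(1)])
    then have "Poly_Mapping.keys v \<subseteq> carrier P \<times> T"
      using u keys_add[of w u] w(2) by blast
    then have "?f v = ?f u \<longleftrightarrow> h_map v - h_map u \<in> rels Q"
      using rcoset_rels_eq_iff h_map_closed u by blast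
    moreover have "h_map v - h_map u = h_map w" using w(2) by (simp add: frag_extend_add)
    ultimately show ?thesis using h_map_rels_iff[OF wk] w(1) by simp
  qed
  moreover have "u \<in> rels P #>\<^bsub>P.freegrp\<^esub> u"
    using group.rcos_self[OF group_free_Abelian_group _ P.rels_subgroup] u by simp
  ultimately have "?f ` (rels P #>\<^bsub>P.freegrp\<^esub> u) = {?f u}" by blast
  then show ?thesis by (simp add: tensor_map_def)
qed

lemma tensor_map_inj: "inj_on (tensor_map Aring Q Tmod h) (carrier (tensor_product Aring P Tmod))"
proof (rule inj_onI)
  fix K L
  assume "K \<in> carrier (tensor_product Aring P Tmod)" "L \<in> carrier (tensor_product Aring P Tmod)"
    and eq: "tensor_map Aring Q Tmod h K = tensor_map Aring Q Tmod h L"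
  then obtain u v where K: "K = rels P #>\<^bsub>P.freegrp\<^esub> u" "Poly_Mapping.keys u \<subseteq> carrier P \<times> T"
    and L: "L = rels P #>\<^bsub>P.freegrp\<^esub> v" "Poly_Mapping.keys v \<subseteq> carrier P \<times> T"
    unfolding tensor_product_def FactGroup_def RCOSETS_def by auto
  have uv: "Poly_Mapping.keys (u - v) \<subseteq> carrier P \<times> T" using K(2) L(2) by (rule keys_diff_subset)
  have "h_map u - h_map v \<in> rels Q"
    using eq tensor_map_rcoset K L rcoset_rels_eq_iff h_map_closed by metis
  then have "u - v \<in> rels P" using h_map_rels_iff[OF uv] by (simp add: frag_extend_diff)
  then show "K = L"
    unfolding K(1) L(1)
    using group.rcoset_eq_iff[OF group_free_Abelian_group P.rels_subgroup, of u v] K(2) L(2) by simp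
qed

end

theorem flat_epimorphic: "flat_epimorphic_extension U S A T"
  unfolding flat_epimorphic_extension_def flat_module_def
  using module_Tmod tensor_map_inj epimorphism by blast

end

section \<open>Extensions of length two\<close>

text \<open>Four rings form a chain of length 3, which exceeds the supremum.\<close>

lemma extension_length_2_no_chain:
  assumes len: "extension_length S A B = 2"
    and I: "T0 \<in> intermediate_rings S A B" "T1 \<in> intermediate_rings S A B"
      "T2 \<in> intermediate_rings S A B" "T3 \<in> intermediate_rings S A B"
    and "T0 \<subset> T1" "T1 \<subset> T2" "T2 \<subset> T3"
  shows False
proof -
  define C where "C i = [T0, T1, T2, T3] ! i" for i
  have "(\<forall>i\<le>3. C i \<in> intermediate_rings S A B) \<and> (\<forall>i<3. C i \<subset> C (Suc i))"
    using assms by (auto simp: C_def numeral_3_eq_3 le_Suc_eq less_Suc_eq)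
  then have "enat 3 \<le> extension_length S A B"
    unfolding extension_length_def by (intro Sup_upper) blast
  then show False by (simp add: len numeral_eq_enat)
qed

lemma extension_length_2_intermediate:
  assumes len: "extension_length S A B = 2"
  shows "\<exists>T \<in> intermediate_rings S A B. T \<noteq> A \<and> T \<noteq> B"
proof (rule ccontr)
  assume no: "\<not> ?thesis"
  have "extension_length S A B \<le> enat 1"
    unfolding extension_length_def
  proof (rule Sup_least, elim CollectE exE conjE)
    fix x n C
    assume x: "x = enat n" and C: "\<forall>i\<le>n. C i \<in> intermediate_rings S A B" "\<forall>i<n. C i \<subset> C (Suc i)"
    have "n \<le> 1"
    proof (rule ccontr)
      assume "\<not> n \<le> 1"
      then have "C 0 \<in> intermediate_rings S A B" "C 1 \<in> intermediate_rings S A B"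
        "C 2 \<in> intermediate_rings S A B" "C 0 \<subset> C 1" "C 1 \<subset> C 2"
        using C by (auto simp: numeral_2_eq_2)
      \<comment> \<open>\<open>C 1\<close> would lie strictly between \<open>A\<close> and
        \<open>B\<close>.\<close>
      then show False using no unfolding intermediate_rings_def by blast
    qed
    then show "x \<le> enat 1" by (simp add: x)
  qed
  then show False by (simp add: len numeral_eq_enat)
qed

section \<open>Intermediate rings and generators\<close>

locale length_2_extension = cring S for S (structure) +
  fixes R
  assumes subring_R: "subring R S" and R_proper: "R \<subset> carrier S"
    and length_2: "extension_length S R (carrier S) = 2"
begin

abbreviation intermediates :: "'a set set" where
  "intermediates \<equiv> intermediate_rings S R (carrier S)"

lemma intermediatesI: "subring T S \<Longrightarrow> R \<subseteq> T \<Longrightarrow> T \<in> intermediates"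
  by (auto simp: intermediate_rings_def dest: subringE(1))

lemma R_intermediate: "R \<in> intermediates" and S_intermediate: "carrier S \<in> intermediates"
  using subring_R R_proper carrier_is_subring by (auto intro!: intermediatesI)

lemma not_minimal: "\<not> minimal_extension S R (carrier S)"
  using extension_length_2_intermediate[OF length_2] unfolding minimal_extension_def by auto

text \<open>A further ring strictly below or above \<open>T\<close> would complete a forbidden chain
  of four rings from \<open>R\<close> to \<open>carrier S\<close>.\<close>

lemma minimal_extensions:
  assumes T: "T \<in> intermediates" "T \<noteq> R" "T \<noteq> carrier S"
  shows "minimal_extension S R T" "minimal_extension S T (carrier S)"
proof -
  have T': "subring T S" "R \<subset> T" "T \<subset> carrier S"
    using T by (auto simp: intermediate_rings_def)
  have "U = R \<or> U = T" if U: "subring U S" "R \<subseteq> U" "U \<subseteq> T" for U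
    using extension_length_2_no_chain[OF length_2 R_intermediate intermediatesI[OF U(1,2)] T(1) S_intermediate]
      U T' by blast
  then show "minimal_extension S R T"
    using T' subring_R unfolding minimal_extension_def intermediate_rings_def by blast
  have "U = T \<or> U = carrier S" if U: "subring U S" "T \<subseteq> U" "U \<subseteq> carrier S" for U
    using extension_length_2_no_chain[OF length_2 R_intermediate T(1) intermediatesI[OF U(1)] S_intermediate]
      U T' by blast
  then show "minimal_extension S T (carrier S)"
    using T' carrier_is_subring unfolding minimal_extension_def intermediate_rings_def by blast
qed

lemma simple_extension_intermediate: "x \<in> carrier S \<Longrightarrow> simple_extension R x \<in> intermediates"
  using simple_extension_subring[OF subring_R] simple_extension_incl[OF subringE(1)[OF subring_R]]
  by (auto intro!: intermediatesI)

lemma simple_extension_neq: "x \<in> carrier S - R \<Longrightarrow> simple_extension R x \<noteq> R"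
  using simple_extension_mem[OF subring_R] by auto

lemma generator_not_in_R:
  assumes "x \<in> carrier S" "carrier S = simple_extension R x"
  shows "x \<in> carrier S - R"
  using assms R_proper simple_extension_subring_incl[OF subring_R order.refl, of x] by blast

text \<open>If \<open>x\<close> outside \<open>R\<close> is not a generator, its simple extension is
  strictly intermediate and so minimal over \<open>R\<close>. A generator would make the whole
  extension minimal, against length 2.\<close>

lemma pointwise_minimal_iff:
  "pointwise_minimal S R (carrier S) \<longleftrightarrow> \<not> (\<exists>x \<in> carrier S. carrier S = simple_extension R x)"
proof
  assume pm: "pointwise_minimal S R (carrier S)"
  show "\<not> (\<exists>x \<in> carrier S. carrier S = simple_extension R x)"
  proof
    assume "\<exists>x \<in> carrier S. carrier S = simple_extension R x"
    then obtain x where x: "x \<in> carrier S - R" "carrier S = simple_extension R x"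
      using generator_not_in_R by blast
    then have "minimal_extension S R (simple_extension R x)"
      using pm by (simp add: pointwise_minimal_def)
    then show False using not_minimal x(2) by simp
  qed
next
  assume "\<not> (\<exists>x \<in> carrier S. carrier S = simple_extension R x)"
  then have "minimal_extension S R (simple_extension R x)" if "x \<in> carrier S - R" for x
    using that by (intro minimal_extensions(1) simple_extension_intermediate simple_extension_neq) auto
  then show "pointwise_minimal S R (carrier S)"
    using R_proper by (simp add: pointwise_minimal_def)
qed

lemma copointwise_minimal_iff:
  "copointwise_minimal S R (carrier S) \<longleftrightarrow> \<not> (\<exists>x \<in> carrier S. carrier S = simple_extension R x)"
proof
  assume "copointwise_minimal S R (carrier S)"
  then show "\<not> (\<exists>x \<in> carrier S. carrier S = simple_extension R x)"
    using generator_not_in_R unfolding copointwise_minimal_def minimal_extension_def by blast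
next
  assume "\<not> (\<exists>x \<in> carrier S. carrier S = simple_extension R x)"
  then have "minimal_extension S (simple_extension R x) (carrier S)" if "x \<in> carrier S - R" for x
    using that by (intro minimal_extensions(2) simple_extension_intermediate simple_extension_neq) auto
  then show "copointwise_minimal S R (carrier S)"
    using R_proper by (simp add: copointwise_minimal_def)
qed

text \<open>A zero ring has no proper subring.\<close>

lemma one_neq_zero: "\<one> \<noteq> \<zero>"
  using one_zeroD R_proper subringE(2)[OF subring_R] by auto

section \<open>The integral closure and the quasi-Pruefer property\<close>

definition closure :: "'a set" where
  "closure = {x. integral_over R x}"

lemma closure_eq: "integral_closure S R (carrier S) = closure"
  using integral_closure_eq[OF subring_R one_neq_zero order.refl]
  by (auto simp: closure_def integral_over_def)

lemma closure_subring: "subring closure S"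
  unfolding closure_def by (rule integral_closure_is_subring[OF subring_R])

lemma R_subset_closure: "R \<subseteq> closure"
  using integral_over_base[OF subring_R] by (auto simp: closure_def)

lemma closure_intermediate: "closure \<in> intermediates"
  using closure_subring R_subset_closure by (rule intermediatesI)

text \<open>Doubling exponents gives both the descending chain that length 2 cuts short and the
  factor 2 in \<open>conductor_unit_of_power\<close>.\<close>

lemma conductor_unit_closure:
  assumes u: "u \<in> carrier S"
  shows "conductor_unit closure u"
proof -
  let ?E = "\<lambda>m::nat. simple_extension closure (u [^] m)"
  have sub: "subring (?E m) S" and inc: "closure \<subseteq> ?E m" and mem: "u [^] m \<in> ?E m" for m
    using simple_extension_subring[OF closure_subring] simple_extension_mem[OF closure_subring]
      simple_extension_incl[OF subringE(1)[OF closure_subring]] u by auto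
  have I: "?E m \<in> intermediates" for m
    using sub inc R_subset_closure by (intro intermediatesI) auto
  have dec: "?E (m + m) \<subseteq> ?E m" for m
    using subringE(6)[OF sub mem mem, of m] u
    by (intro simple_extension_subring_incl[OF sub inc]) (simp add: nat_pow_mult)
  have "\<not> (?E 8 \<subset> ?E 4 \<and> ?E 4 \<subset> ?E 2 \<and> ?E 2 \<subset> ?E 1)"
    using extension_length_2_no_chain[OF length_2 I I I I] by blast
  moreover have "?E 8 \<subseteq> ?E 4" "?E 4 \<subseteq> ?E 2" "?E 2 \<subseteq> ?E 1"
    using dec[of 4] dec[of 2] dec[of 1] unfolding numeral_plus_numeral one_add_one by simp_all
  ultimately have "?E 8 = ?E 4 \<or> ?E 4 = ?E 2 \<or> ?E 2 = ?E 1"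
    by blast
  \<comment> \<open>The repeated exponents 4, 2 and 1 are \<open>Suc m\<close> for \<open>m\<close>
    equal to 3, 1 and 0.\<close>
  then have "\<exists>m. ?E (2 * Suc m) = ?E (Suc m)"
  proof (elim disjE)
    assume "?E 8 = ?E 4" then show ?thesis by (intro exI[of _ 3]) (simp only: mult_Suc_right, simp)
  next
    assume "?E 4 = ?E 2" then show ?thesis by (intro exI[of _ 1]) (simp add: numeral_eq_Suc)
  next
    assume "?E 2 = ?E 1" then show ?thesis by (intro exI[of _ 0]) (simp add: numeral_eq_Suc)
  qed
  then obtain m where "u [^] Suc m \<in> ?E (2 * Suc m)" using mem by metis
  then show ?thesis
    using conductor_unit_of_power[OF closure_subring u] integral_over_trans[OF subring_R]
    by (simp add: closure_def del: nat_pow_Suc mult_Suc_right)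
qed

lemma quasi_pruefer: "quasi_pruefer_extension U S R (carrier S)"
  unfolding quasi_pruefer_extension_def pruefer_extension_def closure_eq
proof
  fix T assume "T \<in> intermediate_rings S closure (carrier S)"
  then have T: "subring T S" "closure \<subseteq> T" by (auto simp: intermediate_rings_def)
  have "conductor_unit closure t" if "t \<in> T" for t
    using that subringE(1)[OF T(1)] by (intro conductor_unit_closure) auto
  then interpret flat_pair S closure T
    by (intro flat_pair.intro subring_pair.intro subring_pair_axioms.intro flat_pair_axioms.intro
        cring_axioms closure_subring T)
  show "flat_epimorphic_extension U S closure T" by (rule flat_epimorphic)
qed

end

theorem proposition2p2:
  fixes S :: "('a, 'b) ring_scheme" and R :: "'a set"
  assumes "cring S"
    and "subring R S"
    and "R \<subset> carrier S"
    and "extension_length S R (carrier S) = 2"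
  shows "(pointwise_minimal S R (carrier S) \<longleftrightarrow> copointwise_minimal S R (carrier S))
    \<and> (pointwise_minimal S R (carrier S) \<or>
         (\<exists>x \<in> carrier S. carrier S = ring.simple_extension S R x))
    \<and> \<not> (pointwise_minimal S R (carrier S) \<and>
         (\<exists>x \<in> carrier S. carrier S = ring.simple_extension S R x))
    \<and> quasi_pruefer_extension TYPE('u) S R (carrier S)
    \<and> (integral_closure S R (carrier S) \<in> {R, carrier S} \<or>
         minimal_extension S R (integral_closure S R (carrier S)) \<and>
         minimal_extension S (integral_closure S R (carrier S)) (carrier S))"
proof -
  interpret length_2_extension S R
    using assms by (intro length_2_extension.intro length_2_extension_axioms.intro)
  \<comment> \<open>If \<open>closure\<close> is neither \<open>R\<close> nor the whole ring, it is
    strictly intermediate and \<open>minimal_extensions\<close> applies to it.\<close>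
  show ?thesis
    using pointwise_minimal_iff copointwise_minimal_iff quasi_pruefer
      minimal_extensions[OF closure_intermediate]
    unfolding closure_eq by blast
qed

end
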